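(* Let $M(1)$ be the rank one Heisenberg vertex operator algebra and fix $n\in\mathbb{Z}_+$. Then $$[\alpha(-1)\mathbf{1}]_{nn}\diamond[\alpha(-1)\mathbf{1}]_{nn}-[\alpha(-1)^2\mathbf{1}]_{nn}+2n[\mathbf{1}]_{nn}$$ is an element of $Q^\infty(M(1))$ that does not satisfy the diagonal shift property. That is, writing this element as $[a]_{nn}$ with $a\in M(1)$, one has $[a]_{nn}\in Q^\infty(M(1))$ and $[a]_{n-1,n-1}\notin Q^\infty(M(1))$.
   Context: All vector spaces are over $\mathbb{C}$; $\mathbb{N}=\{0,1,2,\dots\}$, $\mathbb{Z}_+=\{1,2,\dots\}$; $\binom{a}{m}=a(a-1)\cdots(a-m+1)/m!$ for $a\in\mathbb{Z}$, $m\in\mathbb{N}$. $\mathrm{Res}_x$ denotes the coefficient of $x^{-1}$, and powers of $(1+x)$ are expanded in nonnegative powers of $x$. **Grading-restricted vertex algebra.** A $\mathbb{Z}$-graded vector space $V=\coprod_{n\in\mathbb{Z}}V_{(n)}$ with a linear map $V\to(\mathrm{End}\,V)[[x,x^{-1}]]$, $v\mapsto Y(v,x)=\sum_{n\in\mathbb{Z}}v_nx^{-n-1}$, and a vector $\mathbf{1}\in V_{(0)}$ such that for all $a,b\in V$: (I) $\dim V_{(n)}<\infty$ for all $n$ and $V_{(n)}=0$ for $n$ sufficiently negative; (II) $a_nb=0$ for $n$ sufficiently large; (III) $Y(\mathbf{1},x)=1$; (IV) $Y(a,x)\mathbf{1}\in V[[x]]$ and $\lim_{x\to0}Y(a,x)\mathbf{1}=a$;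 (V) Jacobi identity: for all $l,m,n\in\mathbb{Z}$, $$\sum_{i\ge0}\binom{m}{i}(a_{l+i}b)_{m+n-i}=\sum_{i\ge0}(-1)^i\binom{l}{i}a_{m+l-i}b_{n+i}-\sum_{i\ge0}(-1)^{l+i}\binom{l}{i}b_{n+l-i}a_{m+i};$$ (VI) with $L(0)v=nv$ for $v\in V_{(n)}$, $[L(0),Y(a,x)]=Y(L(0)a,x)+x\frac{d}{dx}Y(a,x)$; (VII) with $L(-1)v=\mathrm{Res}_xx^{-2}Y(v,x)\mathbf{1}$, $\frac{d}{dx}Y(a,x)=Y(L(-1)a,x)=[L(-1),Y(a,x)]$. If $v\in V_{(n)}$, $v$ is homogeneous with $\mathrm{wt}\,v=n$; then $x^{L(0)}v=x^{\mathrm{wt}\,v}v$ and $(1+x)^{L(0)}v=(1+x)^{\mathrm{wt}\,v}v$, extended linearly. Every vertex operator algebra is a grading-restricted vertex algebra. **Lower-bounded generalized $V$-module.** A $\mathbb{C}$-graded vector space $W=\coprod_{n\in\mathbb{C}}W_{(n)}$ with a linear map $V\to(\mathrm{End}\,W)[[x,x^{-1}]]$, $v\mapsto Y_W(v,x)=\sum_{n\in\mathbb{Z}}v_nx^{-n-1}$, such that: $W_{(n)}=0$ when $\mathrm{Re}\,n$ is sufficiently negative; for $a\in V,b\in W$, $a_nb=0$ for $n$ sufficiently large; $Y_W(\mathbf{1},x)=1$; the Jacobi identity (V) holds as an identity of operators on $W$ for $a,b\in V$; there is an operator $L_W(0)$ on $W$ with $[L_W(0),Y_W(a,x)]=Y_W(L(0)a,x)+x\frac{d}{dx}Y_W(a,x)$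 and $W_{(n)}=\{w\in W\mid (L_W(0)-n)^kw=0\text{ for some }k\in\mathbb{Z}_+\}$; there is an operator $L_W(-1)$ on $W$ with $\frac{d}{dx}Y_W(u,x)=Y_W(L(-1)u,x)=[L_W(-1),Y_W(u,x)]$ for $u\in V$. **$U^\infty(V)$ and $\diamond$.** $U^\infty(V)$ is the space of column-finite infinite matrices with entries in $V$, with rows and columns indexed by $\mathbb{N}$ (each column has only finitely many nonzero entries). For $v\in V$, $[v]_{kl}$ is the matrix with entry $v$ in position $(k,l)$ and $0$ elsewhere. The product $\diamond$ is given by $[u]_{km}\diamond[v]_{nl}=0$ if $m\neq n$ and $$[u]_{kn}\diamond[v]_{nl}=\sum_{m=0}^n\binom{-k+n-l-1}{m}\mathrm{Res}_x\,x^{-k+n-l-m-1}(1+x)^l\,[Y((1+x)^{L(0)}u,x)v]_{kl},$$ extended linearly. **$Q^\infty(V)$.** For a lower-bounded generalized $V$-module $W$ and $n\in\mathbb{N}$ let $\Omega_n(W)=\{w\in W\mid v_kw=0\text{ for all homogeneous }v\in V\text{ and }k\in\mathbb{Z}\text{ with }\mathrm{wt}\,v-k-1<-n\}$, $\Omega_{-1}(W)=0$, $\mathrm{Gr}_n(W)=\Omega_n(W)/\Omega_{n-1}(W)$, $\mathrm{Gr}(W)=\bigoplus_{n\in\mathbb{N}}\mathrm{Gr}_n(W)$, and for $w\in\Omega_n(W)$ let $[w]_n=w+\Omega_{n-1}(W)$. Define $\vartheta_{\mathrm{Gr}(W)}:U^\infty(V)\to\mathrm{End}\,\mathrm{Gr}(W)$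 linearly by $\vartheta_{\mathrm{Gr}(W)}([v]_{kl})[w]_n=\delta_{ln}[\mathrm{Res}_x\,x^{l-k-1}Y_W(x^{L(0)}v,x)w]_k$. Then $Q^\infty(V)=\bigcap_W\ker\vartheta_{\mathrm{Gr}(W)}$ over all lower-bounded generalized $V$-modules $W$. **Diagonal shift property.** For $v\in V$, $k,l\in\mathbb{Z}_+$ with $[v]_{kl}\in Q^\infty(V)$, the element $[v]_{kl}$ satisfies the diagonal shift property if $[v]_{k-1,l-1}\in Q^\infty(V)$. **Rank one Heisenberg VOA $M(1)$.** Let $\mathfrak{h}=\mathbb{C}\alpha$ be a one-dimensional (abelian) Lie algebra with bilinear form satisfying $(\alpha,\alpha)=1$; $\widehat{\mathfrak{h}}=\alpha\otimes\mathbb{C}[t,t^{-1}]\oplus\mathbb{C}c$ with $\alpha(m)=\alpha\otimes t^m$, $[\alpha(m),\alpha(n)]=m\delta_{m+n,0}c$, $[\alpha(m),c]=0$. As an $\widehat{\mathfrak{h}}$-module, $M(1)=U(\widehat{\mathfrak{h}})\otimes_{U(\mathfrak{h}\otimes\mathbb{C}[t]\oplus\mathbb{C}c)}\mathbb{C}\mathbf{1}$, where $\mathfrak{h}\otimes\mathbb{C}[t]$ acts trivially on $\mathbb{C}\mathbf{1}$ and $c$ acts as $1$. It carries its standard vertex operator algebra structure, with vacuum $\mathbf{1}$, $Y(\alpha(-1)\mathbf{1},x)=\sum_{n\in\mathbb{Z}}\alpha(n)x^{-n-1}$, conformal vector $\frac12\alpha(-1)^2\mathbf{1}$, and $\mathrm{wt}(\alpha(-i_1)\cdots\alpha(-i_j)\mathbf{1})=i_1+\cdots+i_j$.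 *)

theory Defs
  imports Complex_Main "HOL-Library.Poly_Mapping" "HOL-Library.Groups_Big_Fun"
    "HOL-Library.Function_Algebras"
begin

section \<open>Graded vector spaces\<close>

text \<open>
  A complex vector space lives on a type of class \<open>ab_group_add\<close> together with a scalar
  multiplication. Vertex algebras occupy a whole type; modules are subspaces \<open>W\<close> of their type.
  Since \<open>Sum_any\<close> returns \<open>0\<close> on families with infinite support, it is used below only for
  families whose support is finite.
\<close>

definition homogeneous_parts :: "('i \<Rightarrow> 'a::ab_group_add set) \<Rightarrow> 'a \<Rightarrow> ('i \<Rightarrow> 'a) \<Rightarrow> bool" where
  "homogeneous_parts G w x \<longleftrightarrow> (\<forall>i. x i \<in> G i) \<and> finite {i. x i \<noteq> 0} \<and> w = Sum_any x"

definition direct_sum_decomposition ::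
  "(complex \<Rightarrow> 'a \<Rightarrow> 'a::ab_group_add) \<Rightarrow> 'a set \<Rightarrow> ('i \<Rightarrow> 'a set) \<Rightarrow> bool" where
  "direct_sum_decomposition scale W G \<longleftrightarrow>
     (\<forall>i. module.subspace scale (G i) \<and> G i \<subseteq> W) \<and> (\<forall>w\<in>W. \<exists>!x. homogeneous_parts G w x)"

definition hcomp :: "('i \<Rightarrow> 'a::ab_group_add set) \<Rightarrow> 'a \<Rightarrow> 'i \<Rightarrow> 'a" where
  "hcomp G w = (THE x. homogeneous_parts G w x)"

definition linear_operator_on ::
  "(complex \<Rightarrow> 'a \<Rightarrow> 'a::ab_group_add) \<Rightarrow> 'a set \<Rightarrow> ('a \<Rightarrow> 'a) \<Rightarrow> bool" where
  "linear_operator_on scale W f \<longleftrightarrow>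
     (\<forall>x\<in>W. f x \<in> W) \<and> (\<forall>x\<in>W. \<forall>y\<in>W. f (x + y) = f x + f y) \<and>
     (\<forall>c. \<forall>x\<in>W. f (scale c x) = scale c (f x))"

section \<open>Grading-restricted vertex algebras\<close>

text \<open>
  \<open>Y v n\<close> is the mode \<open>v\<^sub>n\<close>, the coefficient of \<open>x\<close> to the power \<open>-n-1\<close> in \<open>Y(v,x)\<close>.
  All identities between formal series are stated coefficientwise.
\<close>

definition L_zero ::
  "(complex \<Rightarrow> 'v \<Rightarrow> 'v::ab_group_add) \<Rightarrow> (int \<Rightarrow> 'v set) \<Rightarrow> 'v \<Rightarrow> 'v" where
  "L_zero scale grade v = (\<Sum>d. scale (of_int d) (hcomp grade v d))"

definition L_minus_one :: "('v \<Rightarrow> int \<Rightarrow> 'v \<Rightarrow> 'v) \<Rightarrow> 'v \<Rightarrow> 'v \<Rightarrow> 'v" where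
  "L_minus_one Y vac v = Y v (-2) vac"

text \<open>
  The Jacobi identity for the modes \<open>YW\<close> of vertex operators acting on \<open>w\<close>; for the adjoint
  action, \<open>YW = Y\<close>.
\<close>

definition jacobi_identity_at ::
  "(complex \<Rightarrow> 'w \<Rightarrow> 'w::ab_group_add) \<Rightarrow> ('v \<Rightarrow> int \<Rightarrow> 'v \<Rightarrow> 'v) \<Rightarrow> ('v \<Rightarrow> int \<Rightarrow> 'w \<Rightarrow> 'w) \<Rightarrow>
     'v \<Rightarrow> 'v \<Rightarrow> 'w \<Rightarrow> int \<Rightarrow> int \<Rightarrow> int \<Rightarrow> bool" where
  "jacobi_identity_at scale Y YW a b w l m n \<longleftrightarrow>
     (\<Sum>i::nat. scale (of_int m gchoose i) (YW (Y a (l + int i) b) (m + n - int i) w)) =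
     (\<Sum>i::nat. scale ((-1) ^ i * (of_int l gchoose i))
                   (YW a (m + l - int i) (YW b (n + int i) w))) -
     (\<Sum>i::nat. scale ((-1) powi (l + int i) * (of_int l gchoose i))
                   (YW b (n + l - int i) (YW a (m + int i) w)))"

locale grading_restricted_vertex_algebra = vector_space scale
  for scale :: "complex \<Rightarrow> 'v \<Rightarrow> 'v::ab_group_add" +
  fixes grade :: "int \<Rightarrow> 'v set"
    and Y :: "'v \<Rightarrow> int \<Rightarrow> 'v \<Rightarrow> 'v"
    and vac :: 'v
  assumes grading: "direct_sum_decomposition scale UNIV grade"
    and Y_operator: "linear_operator_on scale UNIV (Y v n)"
    and Y_add: "Y (u + v) n b = Y u n b + Y v n b"
    and Y_scale: "Y (scale c v) n b = scale c (Y v n b)"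
    and vac_grade: "vac \<in> grade 0"
    and finite_dimensional: "\<exists>B. finite B \<and> grade d \<subseteq> span B"
    and grade_bounded_below: "\<exists>N. \<forall>d<N. grade d = {0}"
    and truncation: "\<exists>N. \<forall>n\<ge>N. Y a n b = 0"
    and identity: "Y vac n b = (if n = -1 then b else 0)"
    and creation: "n \<ge> 0 \<Longrightarrow> Y a n vac = 0" "Y a (-1) vac = a"
    and jacobi: "jacobi_identity_at scale Y Y a b w l m n"
    and L_zero_commutator:
      "L_zero scale grade (Y a n b) - Y a n (L_zero scale grade b) =
         Y (L_zero scale grade a) n b + scale (of_int (- n - 1)) (Y a n b)"
    and L_minus_one_derivative:
      "Y (L_minus_one Y vac a) n b = scale (of_int (- n)) (Y a (n - 1) b)"
    and L_minus_one_commutator: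
      "L_minus_one Y vac (Y a n b) - Y a n (L_minus_one Y vac b) =
         scale (of_int (- n)) (Y a (n - 1) b)"

locale vertex_operator_algebra =
  grading_restricted_vertex_algebra scale grade Y vac
  for scale :: "complex \<Rightarrow> 'v \<Rightarrow> 'v::ab_group_add" and grade Y vac +
  fixes conf :: 'v and central_charge :: complex
  assumes conf_grade: "conf \<in> grade 2"
    and virasoro:
      "Y conf (m + 1) (Y conf (n + 1) b) - Y conf (n + 1) (Y conf (m + 1) b) =
         scale (of_int (m - n)) (Y conf (m + n + 1) b) +
         (if m + n = 0 then scale (of_int (m ^ 3 - m) / 12 * central_charge) b else 0)"
    and conf_L_zero: "Y conf 1 = L_zero scale grade"
    and conf_L_minus_one: "Y conf 0 = L_minus_one Y vac"

section \<open>Lower-bounded generalized modules\<close>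

locale lower_bounded_generalized_module =
  V: grading_restricted_vertex_algebra scale grade Y vac + W: vector_space scaleW
  for scale :: "complex \<Rightarrow> 'v \<Rightarrow> 'v::ab_group_add" and grade Y vac
    and scaleW :: "complex \<Rightarrow> 'w \<Rightarrow> 'w::ab_group_add" +
  fixes W :: "'w set"
    and gradeW :: "complex \<Rightarrow> 'w set"
    and YW :: "'v \<Rightarrow> int \<Rightarrow> 'w \<Rightarrow> 'w"
  assumes carrier_subspace: "W.subspace W"
    and gradingW: "direct_sum_decomposition scaleW W gradeW"
    and YW_operator: "linear_operator_on scaleW W (YW v n)"
    and YW_add: "w \<in> W \<Longrightarrow> YW (u + v) n w = YW u n w + YW v n w"
    and YW_scale: "w \<in> W \<Longrightarrow> YW (scale c v) n w = scaleW c (YW v n w)"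
    and lower_bounded: "\<exists>N. \<forall>z. Re z < N \<longrightarrow> gradeW z = {0}"
    and truncationW: "w \<in> W \<Longrightarrow> \<exists>N. \<forall>n\<ge>N. YW a n w = 0"
    and identityW: "w \<in> W \<Longrightarrow> YW vac n w = (if n = -1 then w else 0)"
    and jacobiW: "w \<in> W \<Longrightarrow> jacobi_identity_at scaleW Y YW a b w l m n"
    and L_zeroW:
      "\<exists>L0. linear_operator_on scaleW W L0 \<and>
         (\<forall>a n. \<forall>w\<in>W. L0 (YW a n w) - YW a n (L0 w) =
            YW (L_zero scale grade a) n w + scaleW (of_int (- n - 1)) (YW a n w)) \<and>
         (\<forall>z. gradeW z = {w \<in> W. \<exists>k\<ge>1. ((\<lambda>w'. L0 w' - scaleW z w') ^^ k) w = 0})"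
    and L_minus_oneW:
      "\<exists>L1. linear_operator_on scaleW W L1 \<and>
         (\<forall>a n. \<forall>w\<in>W.
            YW (L_minus_one Y vac a) n w = scaleW (of_int (- n)) (YW a (n - 1) w) \<and>
            L1 (YW a n w) - YW a n (L1 w) = scaleW (of_int (- n)) (YW a (n - 1) w))"

section \<open>Column-finite matrices and the product\<close>

definition U_inf :: "(nat \<Rightarrow> nat \<Rightarrow> 'v::zero) set" where
  "U_inf = {A. \<forall>l. finite {k. A k l \<noteq> 0}}"

definition mat_unit :: "'v::zero \<Rightarrow> nat \<Rightarrow> nat \<Rightarrow> nat \<Rightarrow> nat \<Rightarrow> 'v" where
  "mat_unit v k l = (\<lambda>i j. if i = k \<and> j = l then v else 0)"

definition mat_scale ::
  "(complex \<Rightarrow> 'v \<Rightarrow> 'v) \<Rightarrow> complex \<Rightarrow> (nat \<Rightarrow> nat \<Rightarrow> 'v) \<Rightarrow> nat \<Rightarrow> nat \<Rightarrow> 'v" where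
  "mat_scale scale c A = (\<lambda>i j. scale c (A i j))"

text \<open>
  The residue of \<open>x\<^sup>p (1+x)\<^sup>l Y((1+x)\<^bsup>L(0)\<^esup> u, x) v\<close>. For \<open>u\<close> of weight \<open>d\<close> the power of \<open>1+x\<close> is
  \<open>l+d\<close>; its term of degree \<open>j\<close> picks out the mode \<open>p+j\<close> of \<open>u\<close>.
\<close>

definition twisted_residue ::
  "(complex \<Rightarrow> 'v \<Rightarrow> 'v::ab_group_add) \<Rightarrow> (int \<Rightarrow> 'v set) \<Rightarrow> ('v \<Rightarrow> int \<Rightarrow> 'v \<Rightarrow> 'v) \<Rightarrow>
     int \<Rightarrow> int \<Rightarrow> 'v \<Rightarrow> 'v \<Rightarrow> 'v" where
  "twisted_residue scale grade Y p l u v =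
     (\<Sum>d. \<Sum>j::nat. scale (of_int (l + d) gchoose j) (Y (hcomp grade u d) (p + int j) v))"

definition diamond_entry ::
  "(complex \<Rightarrow> 'v \<Rightarrow> 'v::ab_group_add) \<Rightarrow> (int \<Rightarrow> 'v set) \<Rightarrow> ('v \<Rightarrow> int \<Rightarrow> 'v \<Rightarrow> 'v) \<Rightarrow>
     nat \<Rightarrow> nat \<Rightarrow> nat \<Rightarrow> 'v \<Rightarrow> 'v \<Rightarrow> 'v" where
  "diamond_entry scale grade Y k n l u v =
     (\<Sum>m = 0..n. scale (of_int (- int k + int n - int l - 1) gchoose m)
        (twisted_residue scale grade Y (- int k + int n - int l - int m - 1) (int l) u v))"

definition diamond ::
  "(complex \<Rightarrow> 'v \<Rightarrow> 'v::ab_group_add) \<Rightarrow> (int \<Rightarrow> 'v set) \<Rightarrow> ('v \<Rightarrow> int \<Rightarrow> 'v \<Rightarrow> 'v) \<Rightarrow>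
     (nat \<Rightarrow> nat \<Rightarrow> 'v) \<Rightarrow> (nat \<Rightarrow> nat \<Rightarrow> 'v) \<Rightarrow> nat \<Rightarrow> nat \<Rightarrow> 'v" where
  "diamond scale grade Y A B = (\<lambda>k l. \<Sum>n. diamond_entry scale grade Y k n l (A k n) (B n l))"

section \<open>The associated graded space and the ideal\<close>

definition Omega ::
  "(int \<Rightarrow> 'v set) \<Rightarrow> 'w::zero set \<Rightarrow> ('v \<Rightarrow> int \<Rightarrow> 'w \<Rightarrow> 'w) \<Rightarrow> nat \<Rightarrow> 'w set" where
  "Omega grade W YW n =
     {w \<in> W. \<forall>d k. \<forall>v \<in> grade d. d - k - 1 < - int n \<longrightarrow> YW v k w = 0}"

text \<open>\<open>Omega_pred \<dots> n\<close> is the space \<open>\<Omega>\<close> with index \<open>n - 1\<close>, which is zero for the index \<open>-1\<close>.\<close>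

definition Omega_pred ::
  "(int \<Rightarrow> 'v set) \<Rightarrow> 'w::zero set \<Rightarrow> ('v \<Rightarrow> int \<Rightarrow> 'w \<Rightarrow> 'w) \<Rightarrow> nat \<Rightarrow> 'w set" where
  "Omega_pred grade W YW n = (if n = 0 then {0} else Omega grade W YW (n - 1))"

text \<open>
  An element of \<open>Gr(W)\<close> is a family of cosets, one in each quotient, almost all of them
  equal to the zero coset \<open>Omega_pred grade W YW n\<close>.
\<close>

definition Gr_class ::
  "(int \<Rightarrow> 'v set) \<Rightarrow> 'w::ab_group_add set \<Rightarrow> ('v \<Rightarrow> int \<Rightarrow> 'w \<Rightarrow> 'w) \<Rightarrow> nat \<Rightarrow> 'w \<Rightarrow> 'w set" where
  "Gr_class grade W YW n w = {w + x |x. x \<in> Omega_pred grade W YW n}"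

definition Gr ::
  "(int \<Rightarrow> 'v set) \<Rightarrow> 'w::ab_group_add set \<Rightarrow> ('v \<Rightarrow> int \<Rightarrow> 'w \<Rightarrow> 'w) \<Rightarrow> (nat \<Rightarrow> 'w set) set" where
  "Gr grade W YW = {g. (\<forall>n. g n \<in> Gr_class grade W YW n ` Omega grade W YW n) \<and>
     finite {n. g n \<noteq> Omega_pred grade W YW n}}"

text \<open>The residue of \<open>x\<^bsup>l-k-1\<^esup> Y\<^sub>W(x\<^bsup>L(0)\<^esup> v, x) w\<close>.\<close>

definition vartheta_entry ::
  "(int \<Rightarrow> 'v::ab_group_add set) \<Rightarrow> ('v \<Rightarrow> int \<Rightarrow> 'w::ab_group_add \<Rightarrow> 'w) \<Rightarrow>
     nat \<Rightarrow> nat \<Rightarrow> 'v \<Rightarrow> 'w \<Rightarrow> 'w" where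
  "vartheta_entry grade YW k l v w =
     (\<Sum>d. YW (hcomp grade v d) (d + int l - int k - 1) w)"

text \<open>
  The action of a column-finite matrix \<open>A\<close> on \<open>Gr(W)\<close>. The result is formed from all
  choices \<open>r\<close> of representatives of the cosets \<open>g l\<close>, as usual for operations on cosets.
\<close>

definition vartheta ::
  "(int \<Rightarrow> 'v::ab_group_add set) \<Rightarrow> 'w::ab_group_add set \<Rightarrow> ('v \<Rightarrow> int \<Rightarrow> 'w \<Rightarrow> 'w) \<Rightarrow>
     (nat \<Rightarrow> nat \<Rightarrow> 'v) \<Rightarrow> (nat \<Rightarrow> 'w set) \<Rightarrow> nat \<Rightarrow> 'w set" where
  "vartheta grade W YW A g = (\<lambda>k.
     {(\<Sum>l | g l \<noteq> Omega_pred grade W YW l. vartheta_entry grade YW k l (A k l) (r l)) + x |r x.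
        (\<forall>l. r l \<in> g l) \<and> x \<in> Omega_pred grade W YW k})"

definition ker_vartheta ::
  "(int \<Rightarrow> 'v::ab_group_add set) \<Rightarrow> 'w::ab_group_add set \<Rightarrow> ('v \<Rightarrow> int \<Rightarrow> 'w \<Rightarrow> 'w) \<Rightarrow>
     (nat \<Rightarrow> nat \<Rightarrow> 'v) set" where
  "ker_vartheta grade W YW =
     {A \<in> U_inf. \<forall>g \<in> Gr grade W YW. vartheta grade W YW A g = Omega_pred grade W YW}"

text \<open>
  HOL cannot quantify over all types inside a definition, so the intersection is relative to a
  type \<open>'w\<close>: it runs over all modules whose carrier is a subspace of \<open>'w\<close>, for any scalar
  multiplication on \<open>'w\<close>. An element lies in \<open>Q\<^sup>\<infinity>(V)\<close> iff it lies in \<open>Q_inf TYPE('w)\<close> for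
  every \<open>'w\<close>; it lies outside \<open>Q\<^sup>\<infinity>(V)\<close> iff it lies outside \<open>Q_inf TYPE('w)\<close> for some \<open>'w\<close>.
\<close>

definition Q_inf ::
  "'w::ab_group_add itself \<Rightarrow> (complex \<Rightarrow> 'v \<Rightarrow> 'v::ab_group_add) \<Rightarrow> (int \<Rightarrow> 'v set) \<Rightarrow>
     ('v \<Rightarrow> int \<Rightarrow> 'v \<Rightarrow> 'v) \<Rightarrow> 'v \<Rightarrow> (nat \<Rightarrow> nat \<Rightarrow> 'v) set" where
  "Q_inf (_ :: 'w itself) scale grade Y vac =
     {A \<in> U_inf. \<forall>(scaleW :: complex \<Rightarrow> 'w \<Rightarrow> 'w) W gradeW YW.
        lower_bounded_generalized_module scale grade Y vac scaleW W gradeW YW \<longrightarrow>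
        A \<in> ker_vartheta grade W YW}"

text \<open>To be used for \<open>k, l \<ge> 1\<close> and elements \<open>mat_unit v k l\<close> of \<open>Q\<^sup>\<infinity>(V)\<close>.\<close>

definition diagonal_shift_property ::
  "'w::ab_group_add itself \<Rightarrow> (complex \<Rightarrow> 'v \<Rightarrow> 'v::ab_group_add) \<Rightarrow> (int \<Rightarrow> 'v set) \<Rightarrow>
     ('v \<Rightarrow> int \<Rightarrow> 'v \<Rightarrow> 'v) \<Rightarrow> 'v \<Rightarrow> 'v \<Rightarrow> nat \<Rightarrow> nat \<Rightarrow> bool" where
  "diagonal_shift_property T scale grade Y vac v k l \<longleftrightarrow>
     mat_unit v (k - 1) (l - 1) \<in> Q_inf T scale grade Y vac"

section \<open>The rank one Heisenberg vertex operator algebra\<close>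

text \<open>
  The basis of the Heisenberg Lie algebra: \<open>Alpha m\<close> is \<open>\<alpha>(m)\<close> and \<open>Cent\<close> is \<open>c\<close>. The tensor
  algebra is the space of finitely supported functions on words in this basis.
\<close>

datatype heis_gen = Alpha int | Cent

type_synonym heis_tensor = "heis_gen list \<Rightarrow>\<^sub>0 complex"

abbreviation word :: "heis_gen list \<Rightarrow> complex \<Rightarrow> heis_tensor" where
  "word u c \<equiv> Poly_Mapping.single u c"

lift_definition tensor_scale :: "complex \<Rightarrow> heis_tensor \<Rightarrow> heis_tensor"
  is "\<lambda>c f w. c * f w"
  by (auto elim: rev_finite_subset)

lift_definition tensor_cons :: "heis_gen \<Rightarrow> heis_tensor \<Rightarrow> heis_tensor"
  is "\<lambda>a f w. case w of [] \<Rightarrow> 0 | b # w' \<Rightarrow> if b = a then f w' else 0"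
proof -
  fix a :: heis_gen and f :: "heis_gen list \<Rightarrow> complex"
  assume fin: "finite {w. f w \<noteq> 0}"
  have "{w. (case w of [] \<Rightarrow> 0 | b # w' \<Rightarrow> if b = a then f w' else 0) \<noteq> 0} \<subseteq> (#) a ` {w. f w \<noteq> 0}"
  proof
    fix w assume "w \<in> {w. (case w of [] \<Rightarrow> 0 | b # w' \<Rightarrow> if b = a then f w' else 0) \<noteq> 0}"
    then show "w \<in> (#) a ` {w. f w \<noteq> 0}"
      by (cases w) (auto split: if_splits)
  qed
  then show "finite {w. (case w of [] \<Rightarrow> 0 | b # w' \<Rightarrow> if b = a then f w' else 0) \<noteq> 0}"
    using fin finite_surj by blast
qed

interpretation tensor: vector_space tensor_scale
  by unfold_locales (transfer; simp add: fun_eq_iff algebra_simps)+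

text \<open>The coefficient of \<open>Cent\<close> in the Lie bracket of two basis elements.\<close>

fun heis_bracket :: "heis_gen \<Rightarrow> heis_gen \<Rightarrow> complex" where
  "heis_bracket (Alpha m) (Alpha n) = (if m + n = 0 then of_int m else 0)"
| "heis_bracket _ _ = 0"

text \<open>
  The induced module is the tensor algebra modulo the two-sided ideal of the relations
  \<open>ab - ba - [a,b]\<close>, which gives the universal enveloping algebra, and modulo the left ideal
  generated by \<open>b - \<chi>(b)\<close> for \<open>b\<close> in the inducing subalgebra acting on the vacuum through the
  character \<open>\<chi>\<close>.
\<close>

definition heis_relations :: "heis_tensor set" where
  "heis_relations =
     {word (u @ [a, b] @ w) 1 - word (u @ [b, a] @ w) 1 - word (u @ [Cent] @ w) (heis_bracket a b)
        |u a b w. True} \<union>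
     {word (u @ [Alpha m]) 1 |u m. m \<ge> 0} \<union>
     {word (u @ [Cent]) 1 - word u 1 |u. True}"

definition heis_kernel :: "heis_tensor set" where
  "heis_kernel = tensor.span heis_relations"

definition heis_rel :: "heis_tensor \<Rightarrow> heis_tensor \<Rightarrow> bool" where
  "heis_rel p q \<longleftrightarrow> p - q \<in> heis_kernel"

lemma tensor_cons_add: "tensor_cons a (p + q) = tensor_cons a p + tensor_cons a q"
  by transfer (auto simp: fun_eq_iff split: list.splits)

lemma tensor_cons_diff: "tensor_cons a (p - q) = tensor_cons a p - tensor_cons a q"
  by transfer (auto simp: fun_eq_iff split: list.splits)

lemma tensor_cons_scale: "tensor_cons a (tensor_scale c p) = tensor_scale c (tensor_cons a p)"
  by transfer (auto simp: fun_eq_iff split: list.splits)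

lemma tensor_cons_zero: "tensor_cons a 0 = 0"
  by transfer (auto simp: fun_eq_iff split: list.splits)

lemma tensor_cons_word: "tensor_cons a (word u c) = word (a # u) c"
  by transfer (auto simp: fun_eq_iff when_def split: list.splits)

lemma heis_kernel_diff: "p \<in> heis_kernel \<Longrightarrow> q \<in> heis_kernel \<Longrightarrow> p - q \<in> heis_kernel"
  by (simp add: heis_kernel_def tensor.span_diff)

lemma heis_kernel_add: "p \<in> heis_kernel \<Longrightarrow> q \<in> heis_kernel \<Longrightarrow> p + q \<in> heis_kernel"
  by (simp add: heis_kernel_def tensor.span_add)

lemma heis_kernel_scale: "p \<in> heis_kernel \<Longrightarrow> tensor_scale c p \<in> heis_kernel"
  by (simp add: heis_kernel_def tensor.span_scale)

lemma heis_kernel_zero: "0 \<in> heis_kernel"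
  by (simp add: heis_kernel_def tensor.span_zero)

lemma heis_relations_cons:
  assumes "p \<in> heis_relations"
  shows "tensor_cons a p \<in> heis_relations"
proof -
  consider u b c w where "p = word (u @ [b, c] @ w) 1 - word (u @ [c, b] @ w) 1
        - word (u @ [Cent] @ w) (heis_bracket b c)"
    | u m where "p = word (u @ [Alpha m]) 1" "m \<ge> 0"
    | u where "p = word (u @ [Cent]) 1 - word u 1"
    using assms unfolding heis_relations_def by blast
  then show ?thesis
  proof cases
    case (1 u b c w)
    then have "tensor_cons a p = word ((a # u) @ [b, c] @ w) 1 - word ((a # u) @ [c, b] @ w) 1
        - word ((a # u) @ [Cent] @ w) (heis_bracket b c)"
      by (simp add: tensor_cons_diff tensor_cons_word)
    then show ?thesis unfolding heis_relations_def by blast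
  next
    case (2 u m)
    then have "tensor_cons a p = word ((a # u) @ [Alpha m]) 1"
      by (simp add: tensor_cons_word)
    with 2 show ?thesis unfolding heis_relations_def by blast
  next
    case (3 u)
    then have "tensor_cons a p = word ((a # u) @ [Cent]) 1 - word (a # u) 1"
      by (simp add: tensor_cons_diff tensor_cons_word)
    then show ?thesis unfolding heis_relations_def by blast
  qed
qed

lemma heis_kernel_cons:
  assumes "p \<in> heis_kernel"
  shows "tensor_cons a p \<in> heis_kernel"
  using assms unfolding heis_kernel_def
proof (induction rule: tensor.span_induct_alt)
  case base
  then show ?case by (simp add: tensor_cons_zero tensor.span_zero)
next
  case (step c x y)
  then show ?case
    by (simp add: tensor_cons_add tensor_cons_scale tensor.span_add tensor.span_scale
        tensor.span_base heis_relations_cons)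
qed

quotient_type heis_M1 = heis_tensor / heis_rel
proof (rule equivpI)
  show "reflp heis_rel"
    by (simp add: reflp_def heis_rel_def heis_kernel_zero)
  show "symp heis_rel"
    unfolding symp_def heis_rel_def using heis_kernel_diff[OF heis_kernel_zero] by fastforce
  show "transp heis_rel"
    unfolding transp_def heis_rel_def using heis_kernel_add by fastforce
qed

instantiation heis_M1 :: ab_group_add
begin

lift_definition zero_heis_M1 :: heis_M1 is 0 .

lift_definition plus_heis_M1 :: "heis_M1 \<Rightarrow> heis_M1 \<Rightarrow> heis_M1" is "(+)"
  unfolding heis_rel_def by (simp add: add_diff_add heis_kernel_add)

lift_definition minus_heis_M1 :: "heis_M1 \<Rightarrow> heis_M1 \<Rightarrow> heis_M1" is "(-)"
  unfolding heis_rel_def by (drule (1) heis_kernel_diff) (simp add: algebra_simps)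

lift_definition uminus_heis_M1 :: "heis_M1 \<Rightarrow> heis_M1" is "uminus"
  unfolding heis_rel_def by (drule heis_kernel_diff[OF heis_kernel_zero]) simp

instance
  by standard (transfer; simp add: heis_rel_def heis_kernel_zero algebra_simps)+

end

lift_definition heis_scale :: "complex \<Rightarrow> heis_M1 \<Rightarrow> heis_M1" is tensor_scale
  unfolding heis_rel_def by (simp add: heis_kernel_scale flip: tensor.scale_right_diff_distrib)

interpretation heis: vector_space heis_scale
  by unfold_locales
    (transfer; simp add: heis_rel_def heis_kernel_zero tensor.scale_right_distrib
      tensor.scale_left_distrib)+

text \<open>The action of \<open>\<alpha>(m)\<close>.\<close>

lift_definition heis_alpha :: "int \<Rightarrow> heis_M1 \<Rightarrow> heis_M1" is "\<lambda>m. tensor_cons (Alpha m)"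
  unfolding heis_rel_def by (simp add: heis_kernel_cons flip: tensor_cons_diff)

lift_definition heis_vac :: heis_M1 is "word [] 1" .

definition heis_grade :: "int \<Rightarrow> heis_M1 set" where
  "heis_grade d =
     heis.span {foldr (\<lambda>i. heis_alpha (- int i)) js heis_vac |js.
                  (\<forall>i\<in>set js. i \<ge> 1) \<and> int (sum_list js) = d}"

definition heis_conf :: heis_M1 where
  "heis_conf = heis_scale (1 / 2) (heis_alpha (-1) (heis_alpha (-1) heis_vac))"

text \<open>
  \<open>Y\<close> is the standard vertex operator algebra structure on \<open>M(1)\<close>. As \<open>\<alpha>(-1)\<one>\<close> generates \<open>M(1)\<close>,
  there is exactly one such \<open>Y\<close>.
\<close>

definition heisenberg_voa :: "(heis_M1 \<Rightarrow> int \<Rightarrow> heis_M1 \<Rightarrow> heis_M1) \<Rightarrow> bool" where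
  "heisenberg_voa Y \<longleftrightarrow>
     vertex_operator_algebra heis_scale heis_grade Y heis_vac heis_conf 1 \<and>
     (\<forall>m. Y (heis_alpha (-1) heis_vac) m = heis_alpha m)"

end

theory Submission
  imports Defs
begin

text \<open>
  Write \<open>b = \<alpha>(-1)\<one>\<close>. Let \<open>W\<close> be a lower-bounded generalized module and let \<open>w\<close> lie in \<open>\<Omega>\<^sub>l(W)\<close>.
  The three summands of the element act on the class of \<open>w\<close> as follows.

  If \<open>l \<le> n\<close>, the first summand acts on \<open>w\<close> as \<open>\<alpha>(0)\<^sup>2\<close>. The zero mode of each residue in
  \<open>diamond_entry\<close> is the left-hand side of one instance of the Jacobi identity, in which one of the
  two sums on the right vanishes because \<open>\<alpha>(j) w = 0\<close> for \<open>j > n\<close>. Summing over the index of \<open>diamond_entry\<close>, the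
  coefficient of \<open>\<alpha>(-r) \<alpha>(r)\<close> becomes a multiple of an alternating sum of binomial coefficients
  and so is \<open>0\<close> for \<open>r > 0\<close> (\<open>vartheta_entry_diamond_square\<close>).

  The vector \<open>\<alpha>(-1)\<^sup>2\<one>\<close>, which is subtracted, acts by an operator that differs from
  \<open>\<alpha>(0)\<^sup>2\<close> by twice the number
  operator \<open>N = \<Sum>\<^sub>i \<alpha>(-i) \<alpha>(i)\<close>, where \<open>i\<close> runs over the positive integers. On the degree \<open>l\<close>
  part of the associated graded space, \<open>N\<close> is multiplication by \<open>l\<close> (\<open>twice_number_on_Gr\<close>). Indeed
  a mode of degree \<open>s\<close> shifts \<open>N\<close> by \<open>s\<close>, since \<open>\<alpha>(0)\<close> commutes with every mode and \<open>N\<close> differs from the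
  conformal operator only by \<open>\<alpha>(0)\<^sup>2 / 2\<close>; and a mode of degree at most \<open>-l\<close> sends \<open>\<Omega>\<^sub>l(W)\<close> into
  \<open>\<Omega>\<^sub>0(W)\<close>, where \<open>N\<close> is zero.

  Together with the multiple of the vacuum, the element acts on degree \<open>l\<close> as the scalar \<open>2 (n - l)\<close>
  (\<open>square_defect_on_Gr\<close>). For \<open>l = n\<close> this is \<open>0\<close> on every module. For \<open>l = n - 1\<close> it is \<open>2\<close>, and
  it remains to find a module with a nonzero class in degree \<open>n - 1\<close>. In \<open>M(1)\<close> itself the vector
  \<open>\<alpha>(-1)\<^bsup>n-1\<^esup>\<one>\<close> gives one: applying \<open>\<alpha>(1)\<close> repeatedly leads back to a nonzero multiple of \<open>\<one>\<close>,
  whereas each application lowers the index of \<open>\<Omega>\<close>. That \<open>\<one> \<noteq> 0\<close> in the abstract induced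
  module is seen by mapping it to a Fock representation.
\<close>

section \<open>Graded vector spaces\<close>

lemma Sum_any_eq_sum:
  assumes "finite S" and "\<And>i. i \<notin> S \<Longrightarrow> f i = 0"
  shows "Sum_any f = sum f S"
  using assms by (intro Sum_any.expand_superset) auto

locale graded_space = vector_space scale
  for scale :: "complex \<Rightarrow> 'a \<Rightarrow> 'a::ab_group_add" +
  fixes W :: "'a set" and G :: "'i \<Rightarrow> 'a set"
  assumes carrier: "subspace W"
    and decomposition: "direct_sum_decomposition scale W G"
begin

lemma part_subspace: "subspace (G i)" and part_subset: "G i \<subseteq> W"
  using decomposition unfolding direct_sum_decomposition_def by auto

lemma homogeneous_parts_hcomp: "w \<in> W \<Longrightarrow> homogeneous_parts G w (hcomp G w)"
  using decomposition unfolding direct_sum_decomposition_def hcomp_def by (metis (mono_tags) theI')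

lemma hcomp_part: "w \<in> W \<Longrightarrow> hcomp G w i \<in> G i"
  and finite_hcomp: "w \<in> W \<Longrightarrow> finite {i. hcomp G w i \<noteq> 0}"
  and Sum_any_hcomp: "w \<in> W \<Longrightarrow> Sum_any (hcomp G w) = w"
  using homogeneous_parts_hcomp[of w] unfolding homogeneous_parts_def by auto

lemma hcomp_eqI:
  assumes "w \<in> W" and "homogeneous_parts G w x"
  shows "hcomp G w = x"
  using assms homogeneous_parts_hcomp decomposition
  unfolding direct_sum_decomposition_def by blast

lemma hcomp_ext:
  assumes "v \<in> W" "w \<in> W" and "\<And>i. hcomp G v i = hcomp G w i"
  shows "v = w"
  using Sum_any_hcomp[OF assms(1)] Sum_any_hcomp[OF assms(2)] assms(3) by (metis ext)

lemma hcomp_homogeneous: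
  assumes "v \<in> G d"
  shows "hcomp G v = (\<lambda>i. if i = d then v else 0)"
proof (rule hcomp_eqI)
  show "v \<in> W" using assms part_subset by blast
  have "v = Sum_any (\<lambda>i. if i = d then v else 0)"
    by (subst Sum_any_eq_sum[of "{d}"]) auto
  moreover have "finite {i. (if i = d then v else 0) \<noteq> 0}"
    by (rule finite_subset[of _ "{d}"]) auto
  ultimately show "homogeneous_parts G v (\<lambda>i. if i = d then v else 0)"
    using assms subspace_0[OF part_subspace] unfolding homogeneous_parts_def by auto
qed

lemma hcomp_add:
  assumes v: "v \<in> W" and w: "w \<in> W"
  shows "hcomp G (v + w) i = hcomp G v i + hcomp G w i"
proof -
  have "{i. hcomp G v i + hcomp G w i \<noteq> 0} \<subseteq> {i. hcomp G v i \<noteq> 0} \<union> {i. hcomp G w i \<noteq> 0}"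
    by auto
  then have "finite {i. hcomp G v i + hcomp G w i \<noteq> 0}"
    using finite_hcomp[OF v] finite_hcomp[OF w] by (meson finite_UnI finite_subset)
  then have "homogeneous_parts G (v + w) (\<lambda>i. hcomp G v i + hcomp G w i)"
    unfolding homogeneous_parts_def
    using hcomp_part v w subspace_add[OF part_subspace]
      Sum_any.distrib[OF finite_hcomp[OF v] finite_hcomp[OF w]] Sum_any_hcomp by simp
  then show ?thesis using hcomp_eqI subspace_add[OF carrier v w] by metis
qed

lemma hcomp_scale:
  assumes v: "v \<in> W"
  shows "hcomp G (scale c v) i = scale c (hcomp G v i)"
proof -
  have "finite {i. scale c (hcomp G v i) \<noteq> 0}"
    using finite_hcomp[OF v] by (rule rev_finite_subset) auto
  moreover have "scale c v = (\<Sum>i. scale c (hcomp G v i))"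
  proof -
    have "scale c v = scale c (sum (hcomp G v) {i. hcomp G v i \<noteq> 0})"
      using Sum_any_hcomp[OF v] by (simp add: Sum_any.expand_set)
    also have "\<dots> = (\<Sum>i. scale c (hcomp G v i))"
      unfolding scale_sum_right by (rule Sum_any_eq_sum[OF finite_hcomp[OF v], symmetric]) auto
    finally show ?thesis .
  qed
  ultimately have "homogeneous_parts G (scale c v) (\<lambda>i. scale c (hcomp G v i))"
    unfolding homogeneous_parts_def using hcomp_part[OF v] subspace_scale[OF part_subspace] by simp
  then show ?thesis using hcomp_eqI subspace_scale[OF carrier v] by metis
qed

end

section \<open>The weight grading of a vertex algebra\<close>

sublocale grading_restricted_vertex_algebra \<subseteq> graded_space scale UNIV grade
  by unfold_locales (simp_all add: grading)

context grading_restricted_vertex_algebra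
begin

lemma hcomp_zero [simp]: "hcomp grade 0 d = 0"
  using hcomp_scale[of 0 0 d] by simp

lemma hcomp_diff: "hcomp grade (v - w) d = hcomp grade v d - hcomp grade w d"
  using hcomp_add[of "v - w" w d] by (simp add: algebra_simps)

lemma hcomp_L_zero: "hcomp grade (L_zero scale grade v) d = scale (of_int d) (hcomp grade v d)"
proof -
  let ?x = "\<lambda>d. scale (of_int d) (hcomp grade v d)"
  have "{d. ?x d \<noteq> 0} \<subseteq> {d. hcomp grade v d \<noteq> 0}" by auto
  then have "homogeneous_parts grade (L_zero scale grade v) ?x"
    unfolding homogeneous_parts_def L_zero_def
    using finite_subset[OF _ finite_hcomp[OF UNIV_I]] hcomp_part[OF UNIV_I]
      subspace_scale[OF part_subspace] by simp
  then show ?thesis using hcomp_eqI[OF UNIV_I] by metis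
qed

lemma L_zero_add: "L_zero scale grade (v + w) = L_zero scale grade v + L_zero scale grade w"
  by (rule hcomp_ext[OF UNIV_I UNIV_I]) (simp add: hcomp_L_zero hcomp_add scale_right_distrib)

lemma L_zero_scale: "L_zero scale grade (scale c v) = scale c (L_zero scale grade v)"
  by (rule hcomp_ext[OF UNIV_I UNIV_I]) (simp add: hcomp_L_zero hcomp_scale mult.commute)

lemma L_zero_eigenspace: "v \<in> grade d \<longleftrightarrow> L_zero scale grade v = scale (of_int d) v"
proof
  assume "v \<in> grade d"
  then show "L_zero scale grade v = scale (of_int d) v"
    by - (rule hcomp_ext[OF UNIV_I UNIV_I], simp add: hcomp_L_zero hcomp_scale hcomp_homogeneous)
next
  assume L: "L_zero scale grade v = scale (of_int d) v"
  have "hcomp grade v i = 0" if "i \<noteq> d" for i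
  proof -
    have "scale (of_int i) (hcomp grade v i) = scale (of_int d) (hcomp grade v i)"
      using hcomp_L_zero[of v i] L hcomp_scale[OF UNIV_I, of "of_int d" v i] by metis
    then show ?thesis using that by auto
  qed
  then have "v = hcomp grade v d"
    by - (rule hcomp_ext[OF UNIV_I UNIV_I], simp add: hcomp_homogeneous[OF hcomp_part[OF UNIV_I]])
  then show "v \<in> grade d" using hcomp_part[OF UNIV_I, of v d] by metis
qed

lemma Y_zero [simp]: "Y 0 n b = 0" "Y a n 0 = 0"
proof -
  show "Y 0 n b = 0" using Y_scale[of 0 0] by simp
  have "\<forall>c x. Y a n (scale c x) = scale c (Y a n x)"
    using Y_operator unfolding linear_operator_on_def by blast
  then show "Y a n 0 = 0" using scale_zero_left by metis
qed

text \<open>The commutator with \<open>L(0)\<close> makes the mode an eigenvector, and eigenspaces are the graded parts.\<close>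

lemma mode_grade:
  assumes "a \<in> grade d" and "b \<in> grade e"
  shows "Y a n b \<in> grade (d + e - n - 1)"
proof -
  have Y: "Y a n (scale c x) = scale c (Y a n x)" for c x
    using Y_operator unfolding linear_operator_on_def by blast
  have "L_zero scale grade (Y a n b) =
      Y a n (L_zero scale grade b) + Y (L_zero scale grade a) n b + scale (of_int (- n - 1)) (Y a n b)"
    using L_zero_commutator[of a n b] by (simp add: algebra_simps)
  also have "\<dots> = scale (of_int e + of_int d + of_int (- n - 1)) (Y a n b)"
    using assms by (simp add: L_zero_eigenspace Y Y_scale scale_left_distrib)
  also have "of_int e + of_int d + of_int (- n - 1) = (of_int (d + e - n - 1) :: complex)" by simp
  finally show ?thesis using L_zero_eigenspace by simp
qed

section \<open>A vertex algebra as a module over itself\<close>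

text \<open>
  The weight spaces, indexed by complex weights: \<open>complex_grade z\<close> is zero unless \<open>z\<close> is an integer.
  The definition by vanishing of components avoids a case distinction on \<open>z\<close>.
\<close>

definition complex_grade :: "complex \<Rightarrow> 'v set" where
  "complex_grade z = {v. \<forall>d. of_int d \<noteq> z \<longrightarrow> hcomp grade v d = 0}"

lemma complex_grade_of_int: "complex_grade (of_int d) = grade d"
proof
  show "grade d \<subseteq> complex_grade (of_int d)"
    using hcomp_homogeneous unfolding complex_grade_def by auto
  show "complex_grade (of_int d) \<subseteq> grade d"
  proof
    fix v assume "v \<in> complex_grade (of_int d)"
    then have "v = hcomp grade v d"
      by - (rule hcomp_ext[OF UNIV_I UNIV_I],
          auto simp: hcomp_homogeneous[OF hcomp_part[OF UNIV_I]] complex_grade_def)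
    then show "v \<in> grade d" using hcomp_part[OF UNIV_I, of v d] by metis
  qed
qed

lemma complex_grade_non_integer: "z \<notin> range of_int \<Longrightarrow> complex_grade z = {0}"
  unfolding complex_grade_def using hcomp_ext[OF UNIV_I UNIV_I, of _ 0] by force

lemma complex_grading: "direct_sum_decomposition scale UNIV complex_grade"
  unfolding direct_sum_decomposition_def
proof (intro conjI allI ballI)
  show "subspace (complex_grade z)" for z
    unfolding complex_grade_def by (rule subspaceI) (auto simp: hcomp_add hcomp_scale)
  show "complex_grade z \<subseteq> UNIV" for z by simp
next
  fix v
  define y :: "complex \<Rightarrow> 'v" where
    "y z = (if z \<in> range of_int then hcomp grade v \<lfloor>Re z\<rfloor> else 0)" for z
  have y_int: "y (of_int d) = hcomp grade v d" for d unfolding y_def by simp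
  let ?S = "{d. hcomp grade v d \<noteq> 0}"
  have supp: "z \<in> of_int ` ?S" if "y z \<noteq> 0" for z
    using that y_int by (cases "z \<in> range of_int") (auto simp: y_def)
  have "homogeneous_parts complex_grade v y"
    unfolding homogeneous_parts_def
  proof (intro conjI allI)
    show "y z \<in> complex_grade z" for z
      by (cases "z \<in> range of_int")
        (auto simp: y_int complex_grade_of_int hcomp_part, auto simp: y_def complex_grade_non_integer)
    show "finite {z. y z \<noteq> 0}"
      by (rule finite_subset[of _ "of_int ` ?S"]) (use supp finite_hcomp in auto)
    have "Sum_any y = sum y (of_int ` ?S)"
      using supp finite_hcomp by (intro Sum_any_eq_sum) auto
    also have "\<dots> = (\<Sum>d\<in>?S. hcomp grade v d)"
      by (subst sum.reindex) (auto simp: inj_on_def y_int)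
    also have "\<dots> = v"
      using homogeneous_parts_hcomp[of v]
      unfolding homogeneous_parts_def by (simp add: Sum_any.expand_set)
    finally show "v = Sum_any y" by simp
  qed
  moreover have "x = y" if x: "homogeneous_parts complex_grade v x" for x
  proof -
    have x_grade: "x z \<in> complex_grade z" and x_fin: "finite {z. x z \<noteq> 0}" and x_sum: "v = Sum_any x"
      for z using x unfolding homogeneous_parts_def by auto
    have "homogeneous_parts grade v (\<lambda>d. x (of_int d))"
      unfolding homogeneous_parts_def
    proof (intro conjI allI)
      show "x (of_int d) \<in> grade d" for d using x_grade complex_grade_of_int by blast
      have "inj (of_int :: int \<Rightarrow> complex)" by (auto simp: inj_on_def)
      then have fin: "finite (of_int -` {z. x z \<noteq> 0} :: int set)"
        using x_fin finite_vimageI by blast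
      then show "finite {d :: int. x (of_int d) \<noteq> 0}" by (simp add: vimage_def)
      have "z \<in> of_int ` (of_int -` {z. x z \<noteq> 0} :: int set)" if "x z \<noteq> 0" for z
        using that x_grade[of z] complex_grade_non_integer[of z] by auto
      then have "Sum_any x = sum x (of_int ` (of_int -` {z. x z \<noteq> 0} :: int set))"
        using fin by (intro Sum_any_eq_sum) auto
      also have "\<dots> = (\<Sum>d\<in>of_int -` {z. x z \<noteq> 0}. x (of_int d))"
        by (subst sum.reindex) (auto simp: inj_on_def)
      also have "\<dots> = (\<Sum>d::int. x (of_int d))"
        using fin by (intro Sum_any_eq_sum[symmetric]) auto
      finally show "v = (\<Sum>d::int. x (of_int d))" using x_sum by simp
    qed
    then have "hcomp grade v = (\<lambda>d. x (of_int d))" by (rule hcomp_eqI[OF UNIV_I])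
    then have "x (of_int d) = y (of_int d)" for d using y_int by metis
    moreover have "x z = y z" if "z \<notin> range of_int" for z
      using that x_grade[of z] complex_grade_non_integer[OF that] by (simp add: y_def)
    ultimately have "x z = y z" for z by (cases "z \<in> range (of_int :: int \<Rightarrow> complex)") blast+
    then show "x = y" by (rule ext)
  qed
  ultimately show "\<exists>!x. homogeneous_parts complex_grade v x" by (rule ex1I)
qed

text \<open>
  As \<open>L(0)\<close> acts diagonally on homogeneous components, its generalized eigenspaces are its
  eigenspaces.
\<close>

lemma hcomp_L_zero_power:
  "hcomp grade (((\<lambda>v. L_zero scale grade v - scale z v) ^^ k) v) d =
     scale ((of_int d - z) ^ k) (hcomp grade v d)"
proof (induction k)
  case (Suc k)
  let ?x = "((\<lambda>v. L_zero scale grade v - scale z v) ^^ k) v"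
  have "hcomp grade (L_zero scale grade ?x - scale z ?x) d = scale (of_int d - z) (hcomp grade ?x d)"
    unfolding hcomp_diff hcomp_L_zero hcomp_scale[OF UNIV_I] scale_left_diff_distrib ..
  then show ?case using Suc.IH by simp
qed simp

lemma complex_grade_generalized_eigenspace:
  "complex_grade z = {v. \<exists>k\<ge>1. ((\<lambda>v. L_zero scale grade v - scale z v) ^^ k) v = 0}"
proof (intro equalityI subsetI)
  fix v assume v: "v \<in> complex_grade z"
  have "scale ((of_int d - z) ^ 1) (hcomp grade v d) = 0" for d
    using v unfolding complex_grade_def by (cases "of_int d = z") auto
  then have "((\<lambda>v. L_zero scale grade v - scale z v) ^^ 1) v = 0"
    by - (rule hcomp_ext[OF UNIV_I UNIV_I], simp only: hcomp_L_zero_power hcomp_zero)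
  then show "v \<in> {v. \<exists>k\<ge>1. ((\<lambda>v. L_zero scale grade v - scale z v) ^^ k) v = 0}" by blast
next
  fix v assume "v \<in> {v. \<exists>k\<ge>1. ((\<lambda>v. L_zero scale grade v - scale z v) ^^ k) v = 0}"
  then obtain k where "((\<lambda>v. L_zero scale grade v - scale z v) ^^ k) v = 0" by blast
  then have "scale ((of_int d - z) ^ k) (hcomp grade v d) = 0" for d
    using hcomp_L_zero_power[of k z v d] by simp
  then show "v \<in> complex_grade z" unfolding complex_grade_def by auto
qed

lemma adjoint_module:
  "lower_bounded_generalized_module scale grade Y vac scale UNIV complex_grade Y"
proof (unfold_locales, goal_cases)
  case 1 show ?case by simp
next
  case 2 show ?case by (rule complex_grading)
next
  case 3 show ?case by (rule Y_operator)
next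
  case 4 show ?case by (rule Y_add)
next
  case 5 show ?case by (rule Y_scale)
next
  case 6
  obtain N where N: "\<forall>d<N. grade d = {0}" using grade_bounded_below by blast
  have "complex_grade z = {0}" if "Re z < of_int N" for z
  proof (cases "z \<in> range of_int")
    case True
    then show ?thesis using that N by (auto simp: complex_grade_of_int)
  qed (simp add: complex_grade_non_integer)
  then show ?case by blast
next
  case 7 show ?case by (rule truncation)
next
  case 8 show ?case by (rule identity)
next
  case 9 show ?case by (rule jacobi)
next
  case 10
  show ?case
    by (rule exI[of _ "L_zero scale grade"])
      (simp add: linear_operator_on_def L_zero_add L_zero_scale L_zero_commutator
        complex_grade_generalized_eigenspace)
next
  case 11
  show ?case
  proof (intro exI[of _ "L_minus_one Y vac"] conjI allI ballI)
    show "linear_operator_on scale UNIV (L_minus_one Y vac)"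
      by (simp add: linear_operator_on_def L_minus_one_def Y_add Y_scale)
  qed (rule L_minus_one_derivative L_minus_one_commutator)+
qed

end

section \<open>Modules, the filtration and its associated graded space\<close>

context lower_bounded_generalized_module
begin

lemma YW_closed: "w \<in> W \<Longrightarrow> YW v n w \<in> W"
  and YW_vector_add: "w \<in> W \<Longrightarrow> w' \<in> W \<Longrightarrow> YW v n (w + w') = YW v n w + YW v n w'"
  and YW_vector_scale: "w \<in> W \<Longrightarrow> YW v n (scaleW c w) = scaleW c (YW v n w)"
  using YW_operator unfolding linear_operator_on_def by blast+

lemma YW_zero: "w \<in> W \<Longrightarrow> YW 0 n w = 0"
  using YW_scale[of w 0 0 n] by simp

lemma YW_vector_zero [simp]: "YW v n 0 = 0"
  using YW_vector_scale[OF W.subspace_0[OF carrier_subspace], of v n 0] by simp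

lemma YW_vector_diff:
  assumes "w \<in> W" and "w' \<in> W"
  shows "YW v n (w - w') = YW v n w - YW v n w'"
  using YW_vector_add[OF W.subspace_diff[OF carrier_subspace assms] assms(2), of v n]
  by (simp add: algebra_simps)

text \<open>The Jacobi identity with \<open>l = 0\<close>, where only the terms with \<open>i = 0\<close> survive on the right.\<close>

lemma commutator_formula:
  assumes w: "w \<in> W"
  shows "YW a m (YW b n w) - YW b n (YW a m w) =
    (\<Sum>i::nat. scaleW (of_int m gchoose i) (YW (Y a (int i) b) (m + n - int i) w))"
proof -
  have "(\<Sum>i::nat. scaleW ((-1) ^ i * (of_int 0 gchoose i))
      (YW a (m + 0 - int i) (YW b (n + int i) w))) = YW a m (YW b n w)"
    by (subst Sum_any_eq_sum[of "{0}"]) (auto simp: gbinomial_0_left)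
  moreover have "(\<Sum>i::nat. scaleW ((-1) powi (0 + int i) * (of_int 0 gchoose i))
      (YW b (n + 0 - int i) (YW a (m + int i) w))) = YW b n (YW a m w)"
    by (subst Sum_any_eq_sum[of "{0}"]) (auto simp: gbinomial_0_left)
  ultimately show ?thesis
    using jacobiW[OF w, of a b 0 m n] unfolding jacobi_identity_at_def by simp
qed

lemma Omega_subset: "Omega grade W YW n \<subseteq> W"
  and Omega_vanish: "w \<in> Omega grade W YW n \<Longrightarrow> v \<in> grade d \<Longrightarrow> d - k - 1 < - int n \<Longrightarrow> YW v k w = 0"
  unfolding Omega_def by auto

lemma Omega_subspace: "W.subspace (Omega grade W YW n)"
proof (rule W.subspaceI)
  show "0 \<in> Omega grade W YW n"
    unfolding Omega_def using W.subspace_0[OF carrier_subspace] by simp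
next
  fix x y assume "x \<in> Omega grade W YW n" "y \<in> Omega grade W YW n"
  then show "x + y \<in> Omega grade W YW n"
    unfolding Omega_def using W.subspace_add[OF carrier_subspace] by (auto simp: YW_vector_add)
next
  fix c x assume "x \<in> Omega grade W YW n"
  then show "scaleW c x \<in> Omega grade W YW n"
    unfolding Omega_def using W.subspace_scale[OF carrier_subspace] by (auto simp: YW_vector_scale)
qed

lemma Omega_mono:
  assumes mn: "m \<le> n"
  shows "Omega grade W YW m \<subseteq> Omega grade W YW n"
proof
  fix w assume w: "w \<in> Omega grade W YW m"
  have "YW v k w = 0" if "v \<in> grade d" "d - k - 1 < - int n" for v d k
    by (rule Omega_vanish[OF w that(1)]) (use that mn in linarith)
  then show "w \<in> Omega grade W YW n" using w unfolding Omega_def by blast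
qed

lemma Omega_pred_subspace: "W.subspace (Omega_pred grade W YW n)"
  unfolding Omega_pred_def using Omega_subspace W.subspace_single_0 by simp

lemma Omega_pred_subset: "Omega_pred grade W YW n \<subseteq> Omega grade W YW n"
  unfolding Omega_pred_def using Omega_mono[of "n - 1" n] W.subspace_0[OF Omega_subspace] by auto

text \<open>
  Although \<open>\<Omega>\<close> is defined by single modes, products of two modes of sufficiently negative total
  degree kill it too. For \<open>M\<close> with \<open>u\<^sub>M w = u\<^sub>M\<^sub>+\<^sub>1 w = \<dots> = 0\<close> the Jacobi identity expresses
  \<open>u\<^sub>p v\<^sub>q w\<close> through single modes of the same total degree and the products \<open>u\<^sub>p\<^sub>-\<^sub>i v\<^sub>q\<^sub>+\<^sub>i w\<close> with
  \<open>i > 0\<close>. Since \<open>v\<^sub>q w = 0\<close> for large \<open>q\<close>, downward induction on \<open>q\<close> applies.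
\<close>

lemma Omega_product_vanish:
  assumes w: "w \<in> Omega grade W YW n" and u: "u \<in> grade d" and v: "v \<in> grade e"
    and deg: "(d - p - 1) + (e - q - 1) < - int n"
  shows "YW u p (YW v q w) = 0"
proof -
  have wW: "w \<in> W" using w Omega_subset by blast
  obtain M0 where M0: "\<forall>i\<ge>M0. YW u i w = 0" using truncationW[OF wW] by blast
  define M where "M = max 0 M0"
  obtain Q where Q: "\<forall>i\<ge>Q. YW v i w = 0" using truncationW[OF wW] by blast
  have "YW u p' (YW v q' w) = 0" if "p' + q' = p + q" for p' q'
    using that
  proof (induction "nat (Q - q')" arbitrary: p' q' rule: less_induct)
    case less
    show ?case
    proof (cases "q' \<ge> Q")
      case True
      then show ?thesis using Q by simp
    next
      case False
      have "YW (Y u (p' - M + int i) v) (M + q' - int i) w = 0" for i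
        by (rule Omega_vanish[OF w V.mode_grade[OF u v]]) (use less.prems deg in linarith)
      moreover have "YW u (M + int i) w = 0" for i
        using M0 unfolding M_def by simp
      ultimately have "(\<Sum>i::nat. scaleW ((-1) ^ i * (of_int (p' - M) gchoose i))
          (YW u (M + (p' - M) - int i) (YW v (q' + int i) w))) = 0"
        using jacobiW[OF wW, of u v "p' - M" M q'] unfolding jacobi_identity_at_def by simp
      moreover have "YW u (M + (p' - M) - int i) (YW v (q' + int i) w) = 0" if "i \<noteq> 0" for i
        using False that less.prems by (intro less.hyps) auto
      then have "(\<Sum>i::nat. scaleW ((-1) ^ i * (of_int (p' - M) gchoose i))
          (YW u (M + (p' - M) - int i) (YW v (q' + int i) w))) = YW u p' (YW v q' w)"
        by (subst Sum_any_eq_sum[of "{0}"]) auto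
      ultimately show ?thesis by simp
    qed
  qed
  then show ?thesis by blast
qed

text \<open>In terms of degrees: a mode of degree \<open>s\<close> maps \<open>\<Omega>\<^sub>n\<close> into \<open>\<Omega>\<^sub>n\<^sub>+\<^sub>s\<close>.\<close>

lemma Omega_mode:
  assumes w: "w \<in> Omega grade W YW n" and v: "v \<in> grade d"
    and deg: "int n + (d - k - 1) \<le> int m"
  shows "YW v k w \<in> Omega grade W YW m"
  unfolding Omega_def
proof (intro CollectI conjI allI ballI impI)
  show "YW v k w \<in> W" using w Omega_subset YW_closed by blast
  fix e j u assume "u \<in> grade e" and "e - j - 1 < - int m"
  then show "YW u j (YW v k w) = 0"
    using deg by (intro Omega_product_vanish[OF w _ v]) auto
qed

lemma vartheta_entry_eq_sum:
  assumes "w \<in> W" and "finite S" and "\<And>d. d \<notin> S \<Longrightarrow> hcomp grade v d = 0"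
  shows "vartheta_entry grade YW k l v w =
    (\<Sum>d\<in>S. YW (hcomp grade v d) (d + int l - int k - 1) w)"
  unfolding vartheta_entry_def
  by (rule Sum_any_eq_sum[OF assms(2)]) (simp add: assms(3) YW_zero[OF assms(1)])

lemma vartheta_entry_homogeneous:
  assumes "w \<in> W" and "v \<in> grade d"
  shows "vartheta_entry grade YW k l v w = YW v (d + int l - int k - 1) w"
  using vartheta_entry_eq_sum[OF assms(1), of "{d}" v k l] V.hcomp_homogeneous[OF assms(2)] by simp

lemma vartheta_entry_add:
  assumes w: "w \<in> W"
  shows "vartheta_entry grade YW k l (u + v) w =
    vartheta_entry grade YW k l u w + vartheta_entry grade YW k l v w"
proof -
  let ?S = "{d. hcomp grade u d \<noteq> 0} \<union> {d. hcomp grade v d \<noteq> 0}"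
  have fin: "finite ?S" using V.finite_hcomp[OF UNIV_I] by blast
  have "vartheta_entry grade YW k l (u + v) w =
      (\<Sum>d\<in>?S. YW (hcomp grade (u + v) d) (d + int l - int k - 1) w)"
    using V.hcomp_add[OF UNIV_I UNIV_I] by (intro vartheta_entry_eq_sum[OF w fin]) simp
  also have "\<dots> = (\<Sum>d\<in>?S. YW (hcomp grade u d) (d + int l - int k - 1) w) +
      (\<Sum>d\<in>?S. YW (hcomp grade v d) (d + int l - int k - 1) w)"
    by (simp add: V.hcomp_add YW_add[OF w] sum.distrib)
  finally show ?thesis
    using vartheta_entry_eq_sum[OF w fin, of u] vartheta_entry_eq_sum[OF w fin, of v] by simp
qed

lemma vartheta_entry_scale:
  assumes w: "w \<in> W"
  shows "vartheta_entry grade YW k l (scale c v) w = scaleW c (vartheta_entry grade YW k l v w)"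
proof -
  let ?S = "{d. hcomp grade v d \<noteq> 0}"
  have fin: "finite ?S" using V.finite_hcomp[OF UNIV_I] .
  have "vartheta_entry grade YW k l (scale c v) w =
      (\<Sum>d\<in>?S. YW (hcomp grade (scale c v) d) (d + int l - int k - 1) w)"
    using V.hcomp_scale[OF UNIV_I] by (intro vartheta_entry_eq_sum[OF w fin]) simp
  also have "\<dots> = scaleW c (\<Sum>d\<in>?S. YW (hcomp grade v d) (d + int l - int k - 1) w)"
    by (simp add: V.hcomp_scale YW_scale[OF w] W.scale_sum_right)
  finally show ?thesis using vartheta_entry_eq_sum[OF w fin, of v] by simp
qed

lemma vartheta_entry_zero: "w \<in> W \<Longrightarrow> vartheta_entry grade YW k l 0 w = 0"
  using vartheta_entry_scale[of w k l 0 0] by simp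

lemma vartheta_entry_diff:
  assumes "w \<in> W"
  shows "vartheta_entry grade YW k l (u - v) w =
    vartheta_entry grade YW k l u w - vartheta_entry grade YW k l v w"
  using vartheta_entry_add[OF assms, of k l "u - v" v] by (simp add: algebra_simps)

lemma vartheta_entry_sum:
  assumes "w \<in> W"
  shows "vartheta_entry grade YW k l (sum f A) w = (\<Sum>i\<in>A. vartheta_entry grade YW k l (f i) w)"
  by (induction A rule: infinite_finite_induct)
    (simp_all add: vartheta_entry_zero[OF assms] vartheta_entry_add[OF assms])

text \<open>
  This reduces the action on families of cosets to representatives. Those in \<open>\<Omega>\<^sub>l\<^sub>-\<^sub>1\<close> are excluded
  because a zero coset contributes nothing to the sum that defines \<open>vartheta\<close>.
\<close>

lemma mat_unit_in_ker_vartheta_iff: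
  "mat_unit v k l \<in> ker_vartheta grade W YW \<longleftrightarrow>
    (\<forall>w \<in> Omega grade W YW l - Omega_pred grade W YW l.
      vartheta_entry grade YW k l v w \<in> Omega_pred grade W YW k)"
proof -
  let ?P = "Omega_pred grade W YW"
  note P0 = W.subspace_0[OF Omega_pred_subspace] and Padd = W.subspace_add[OF Omega_pred_subspace]
    and Pdiff = W.subspace_diff[OF Omega_pred_subspace]
  have mat_U: "mat_unit v k l \<in> U_inf"
    unfolding U_inf_def mat_unit_def by (auto intro: finite_subset[of _ "{k}"])
  have "vartheta_entry grade YW k l v w \<in> ?P k"
    if ker: "mat_unit v k l \<in> ker_vartheta grade W YW" and w: "w \<in> Omega grade W YW l - ?P l" for w
  proof -
    define g where "g i = (if i = l then Gr_class grade W YW l w else ?P i)" for i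
    define r where "r i = (if i = l then w else 0)" for i
    have "?P i = Gr_class grade W YW i 0" for i unfolding Gr_class_def by simp
    moreover have "finite {n. g n \<noteq> ?P n}" by (rule finite_subset[of _ "{l}"]) (auto simp: g_def)
    ultimately have "g \<in> Gr grade W YW"
      unfolding Gr_def g_def using w W.subspace_0[OF Omega_subspace] by fastforce
    then have van: "vartheta grade W YW (mat_unit v k l) g k = ?P k"
      using ker unfolding ker_vartheta_def by simp
    have w_class: "w \<in> Gr_class grade W YW l w"
      unfolding Gr_class_def using P0 by (auto intro: exI[of _ 0])
    have r: "r i \<in> g i" for i
      unfolding r_def g_def using w_class P0 by auto
    have "{i. g i \<noteq> ?P i} = {l}" unfolding g_def using w_class w by auto
    then have "(\<Sum>i | g i \<noteq> ?P i. vartheta_entry grade YW k i (mat_unit v k l k i) (r i)) + 0 =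
        vartheta_entry grade YW k l v w"
      by (simp add: mat_unit_def r_def)
    moreover have "(\<Sum>i | g i \<noteq> ?P i. vartheta_entry grade YW k i (mat_unit v k l k i) (r i)) + 0
        \<in> vartheta grade W YW (mat_unit v k l) g k"
      unfolding vartheta_def using r P0[of k] by blast
    ultimately have "vartheta_entry grade YW k l v w \<in> vartheta grade W YW (mat_unit v k l) g k"
      by simp
    then show "vartheta_entry grade YW k l v w \<in> ?P k" using van by simp
  qed
  moreover have "mat_unit v k l \<in> ker_vartheta grade W YW"
    if act: "\<forall>w \<in> Omega grade W YW l - ?P l. vartheta_entry grade YW k l v w \<in> ?P k"
  proof -
    have "vartheta grade W YW (mat_unit v k l) g = ?P" if g: "g \<in> Gr grade W YW" for g
    proof
      fix j
      let ?S = "\<lambda>r. \<Sum>i | g i \<noteq> ?P i. vartheta_entry grade YW j i (mat_unit v k l j i) (r i)"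
      have g_cosets: "\<exists>w \<in> Omega grade W YW i. g i = Gr_class grade W YW i w" for i
      proof -
        have "g i \<in> Gr_class grade W YW i ` Omega grade W YW i" using g unfolding Gr_def by simp
        then show ?thesis by (elim imageE) (rule bexI)
      qed
      have g_Omega: "x \<in> Omega grade W YW i" if "x \<in> g i" for x i
      proof -
        obtain w where w: "w \<in> Omega grade W YW i" "g i = Gr_class grade W YW i w"
          using g_cosets[of i] by (elim bexE)
        from that have "x \<in> {w + y |y. y \<in> ?P i}" unfolding w(2) Gr_class_def .
        then obtain y where y: "x = w + y" "y \<in> ?P i" by blast
        have "y \<in> Omega grade W YW i" using y(2) Omega_pred_subset by blast
        then show ?thesis unfolding y(1) by (rule W.subspace_add[OF Omega_subspace w(1)])
      qed
      have g_pred: "g i = ?P i" if "x \<in> g i" "x \<in> ?P i" for x i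
      proof -
        obtain w where w: "g i = Gr_class grade W YW i w" using g_cosets[of i] by (elim bexE)
        from that(1) have "x \<in> {w + y |y. y \<in> ?P i}" unfolding w Gr_class_def .
        then obtain y where y: "x = w + y" "y \<in> ?P i" by blast
        have "w = x - y" using y by simp
        then have wP: "w \<in> ?P i" using Pdiff[OF that(2) y(2)] by simp
        show ?thesis unfolding w Gr_class_def
        proof (intro equalityI subsetI)
          fix z assume "z \<in> ?P i"
          then have "z - w \<in> ?P i" and "z = w + (z - w)" using Pdiff wP by auto
          then show "z \<in> {w + x |x. x \<in> ?P i}" by blast
        qed (use Padd wP in auto)
      qed
      have S: "?S r \<in> ?P j" if r: "\<forall>i. r i \<in> g i" for r
      proof (rule W.subspace_sum[OF Omega_pred_subspace])
        fix i assume i: "i \<in> {i. g i \<noteq> ?P i}"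
        then have ri: "r i \<in> Omega grade W YW i - ?P i" using r g_Omega g_pred by blast
        then have "r i \<in> W" using Omega_subset by blast
        then show "vartheta_entry grade YW j i (mat_unit v k l j i) (r i) \<in> ?P j"
          using act ri P0 by (auto simp: mat_unit_def vartheta_entry_zero)
      qed
      define r where "r i = (SOME x. x \<in> g i)" for i
      have "g i \<noteq> {}" for i
      proof -
        obtain w where "g i = Gr_class grade W YW i w" using g_cosets[of i] by (elim bexE)
        then show ?thesis unfolding Gr_class_def using P0[of i] by blast
      qed
      then have r: "\<forall>i. r i \<in> g i" unfolding r_def some_in_eq by blast
      show "vartheta grade W YW (mat_unit v k l) g j = ?P j"
        unfolding vartheta_def
      proof (intro equalityI subsetI)
        fix z assume "z \<in> ?P j"
        then have "z - ?S r \<in> ?P j" and "z = ?S r + (z - ?S r)" using Pdiff S[OF r] by auto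
        then show "z \<in> {?S r + x |r x. (\<forall>i. r i \<in> g i) \<and> x \<in> ?P j}" using r by blast
      qed (use S Padd in auto)
    qed
    then show "mat_unit v k l \<in> ker_vartheta grade W YW"
      unfolding ker_vartheta_def using mat_U by blast
  qed
  ultimately show ?thesis by blast
qed

end

section \<open>Modules for the free boson\<close>

text \<open>
  Trinomial revision turns the summand into a multiple of \<open>(-1)\<^sup>m\<close> times \<open>r choose m\<close>. This is the
  cancellation for which the truncated binomial series in the product \<open>\<diamond>\<close> is designed.
\<close>

lemma alternating_gbinomial_sum:
  fixes x :: "'a::field_char_0"
  shows "(\<Sum>m\<le>r. (x gchoose m) * ((-1) ^ (r - m) * (x - of_nat m gchoose (r - m)))) =
    (if r = 0 then 1 else 0)"
proof -
  have "(x gchoose m) * ((-1) ^ (r - m) * (x - of_nat m gchoose (r - m))) =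
      (x gchoose r) * ((-1) ^ r * ((-1) ^ m * of_nat (r choose m)))" if "m \<le> r" for m
  proof -
    have "(-1 :: 'a) ^ (r - m) = (-1) ^ r * (-1) ^ m"
      using that by (simp add: minus_one_power_iff)
    then show ?thesis
      using gbinomial_trinomial_revision[OF that, of x] by (simp add: binomial_gbinomial mult_ac)
  qed
  then have "(\<Sum>m\<le>r. (x gchoose m) * ((-1) ^ (r - m) * (x - of_nat m gchoose (r - m)))) =
      (x gchoose r) * ((-1) ^ r * (\<Sum>m\<le>r. (-1) ^ m * of_nat (r choose m)))"
    by (simp add: sum_distrib_left)
  then show ?thesis using choose_alternating_sum[of r, where ?'a = 'a] by simp
qed

context grading_restricted_vertex_algebra
begin

lemma diamond_mat_unit:
  "diamond scale grade Y (mat_unit u k n) (mat_unit v n l) =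
    mat_unit (diamond_entry scale grade Y k n l u v) k l"
proof (intro ext)
  fix i j
  have zero: "diamond_entry scale grade Y k' n' l' 0 v' = 0"
    "diamond_entry scale grade Y k' n' l' u' 0 = 0" for k' n' l' u' v'
    unfolding diamond_entry_def twisted_residue_def by simp_all
  have "diamond scale grade Y (mat_unit u k n) (mat_unit v n l) i j =
      diamond_entry scale grade Y i n j (mat_unit u k n i n) (mat_unit v n l n j)"
    unfolding diamond_def by (subst Sum_any_eq_sum[of "{n}"]) (auto simp: mat_unit_def zero)
  then show "diamond scale grade Y (mat_unit u k n) (mat_unit v n l) i j =
      mat_unit (diamond_entry scale grade Y k n l u v) k l i j"
    by (auto simp: mat_unit_def zero)
qed

text \<open>
  The failure of \<open>[a]\<^sub>n\<^sub>n \<diamond> [a]\<^sub>n\<^sub>n\<close> to equal \<open>[a\<^sub>-\<^sub>1 a]\<^sub>n\<^sub>n\<close>, corrected by the multiple of the vacuum by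
  which the two differ on degree \<open>n\<close>.
\<close>

definition square_defect :: "'v \<Rightarrow> nat \<Rightarrow> 'v" where
  "square_defect a n =
     diamond_entry scale grade Y n n n a a - Y a (-1) a + scale (2 * of_nat n) vac"

lemma square_defect_matrix:
  "diamond scale grade Y (mat_unit a n n) (mat_unit a n n) - mat_unit (Y a (-1) a) n n
      + mat_scale scale (2 * of_nat n) (mat_unit vac n n) = mat_unit (square_defect a n) n n"
  unfolding diamond_mat_unit square_defect_def
  by (auto simp: fun_eq_iff mat_unit_def mat_scale_def)

end

text \<open>
  All that is used of the Heisenberg algebra when it acts on a module: a weight one vector \<open>a\<close>
  whose square gives the conformal vector, with \<open>a\<^sub>0 = 0\<close> on the vertex algebra.
\<close>

locale free_boson_module =
  lower_bounded_generalized_module scale grade Y vac scaleW W gradeW YW +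
  U: vertex_operator_algebra scale grade Y vac conf central_charge
  for scale :: "complex \<Rightarrow> 'v \<Rightarrow> 'v::ab_group_add" and grade Y vac
    and scaleW :: "complex \<Rightarrow> 'w \<Rightarrow> 'w::ab_group_add" and W gradeW YW conf central_charge +
  fixes a :: 'v
  assumes boson_grade: "a \<in> grade 1"
    and boson_conf: "conf = scale (1 / 2) (Y a (-1) a)"
    and boson_zero_mode: "Y a 0 v = 0"
begin

lemma zero_mode_commute:
  assumes w: "w \<in> W"
  shows "YW a 0 (YW v k w) = YW v k (YW a 0 w)"
proof -
  have "YW a 0 (YW v k w) - YW v k (YW a 0 w) =
      (\<Sum>i::nat. scaleW (of_int 0 gchoose i) (YW (Y a (int i) v) (0 + k - int i) w))"
    by (rule commutator_formula[OF w])
  also have "\<dots> = 0"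
    by (subst Sum_any_eq_sum[of "{0}"]) (auto simp: gbinomial_0_left boson_zero_mode YW_zero[OF w])
  finally show ?thesis by simp
qed

text \<open>
  The commutator formula has two terms here, and the modes \<open>0\<close> and \<open>1\<close> of the conformal vector on
  the vertex algebra are \<open>L(-1)\<close> and \<open>L(0)\<close>.
\<close>

lemma conf_commutator:
  assumes w: "w \<in> W" and v: "v \<in> grade d"
  shows "YW conf 1 (YW v k w) - YW v k (YW conf 1 w) = scaleW (of_int (d - k - 1)) (YW v k w)"
proof -
  obtain L1 where L1: "\<forall>a n. \<forall>w\<in>W.
      YW (L_minus_one Y vac a) n w = scaleW (of_int (- n)) (YW a (n - 1) w) \<and>
      L1 (YW a n w) - YW a n (L1 w) = scaleW (of_int (- n)) (YW a (n - 1) w)"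
    using L_minus_oneW by blast
  have choose: "(1 :: complex) gchoose i = of_nat (1 choose i)" for i
    using binomial_gbinomial[of 1 i, where ?'a = complex] by simp
  have "YW conf 1 (YW v k w) - YW v k (YW conf 1 w) =
      (\<Sum>i::nat. scaleW (of_int 1 gchoose i) (YW (Y conf (int i) v) (1 + k - int i) w))"
    by (rule commutator_formula[OF w])
  also have "\<dots> = YW (Y conf 0 v) (k + 1) w + YW (Y conf 1 v) k w"
    by (subst Sum_any_eq_sum[of "{0, 1}"]) (auto simp: choose binomial_eq_0 add.commute)
  also have "YW (Y conf 0 v) (k + 1) w = scaleW (of_int (- (k + 1))) (YW v k w)"
  proof -
    have "YW (L_minus_one Y vac v) (k + 1) w = scaleW (of_int (- (k + 1))) (YW v (k + 1 - 1) w)"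
      using L1 w by blast
    then show ?thesis unfolding U.conf_L_minus_one by simp
  qed
  also have "YW (Y conf 1 v) k w = scaleW (of_int d) (YW v k w)"
    using V.L_zero_eigenspace v by (simp add: U.conf_L_zero YW_scale[OF w])
  also have "scaleW (of_int (- (k + 1))) (YW v k w) + scaleW (of_int d) (YW v k w) =
      scaleW (of_int (d - k - 1)) (YW v k w)"
    by (simp flip: W.scale_left_distrib)
  finally show ?thesis .
qed

text \<open>
  This is \<open>2 \<Sum>\<^sub>i a\<^sub>-\<^sub>i a\<^sub>i\<close> over \<open>i > 0\<close>. Written as a difference, its commutators with modes follow from
  those of the conformal operator, without manipulating an infinite sum.
\<close>

definition twice_number :: "'w \<Rightarrow> 'w" where
  "twice_number w = YW (Y a (-1) a) 1 w - YW a 0 (YW a 0 w)"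

lemma twice_number_commutator:
  assumes w: "w \<in> W" and v: "v \<in> grade d"
  shows "twice_number (YW v k w) =
    YW v k (twice_number w) + scaleW (2 * of_int (d - k - 1)) (YW v k w)"
proof -
  have a2: "YW (Y a (-1) a) 1 x = scaleW 2 (YW conf 1 x)" if "x \<in> W" for x
    unfolding boson_conf using that by (simp add: YW_scale)
  have "YW a 0 (YW a 0 (YW v k w)) = YW v k (YW a 0 (YW a 0 w))"
    using zero_mode_commute[OF w, of v k] zero_mode_commute[OF YW_closed[OF w], of v k a 0] by metis
  moreover have "YW conf 1 (YW v k w) = YW v k (YW conf 1 w) + scaleW (of_int (d - k - 1)) (YW v k w)"
    using conf_commutator[OF w v, of k] by (simp add: algebra_simps)
  ultimately show ?thesis
    unfolding twice_number_def
    using w by (simp add: a2 YW_closed YW_vector_diff W.subspace_scale[OF carrier_subspace]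
        YW_vector_scale W.scale_right_distrib del: of_int_diff)
qed

text \<open>
  The Jacobi identity with \<open>l = -1\<close> is the normally ordered expansion of the zero mode of \<open>a\<^sub>-\<^sub>1 a\<close>;
  on \<open>\<Omega>\<^sub>0\<close> all positive modes of \<open>a\<close> vanish, and only \<open>a\<^sub>0 a\<^sub>0\<close> is left.
\<close>

lemma twice_number_Omega_0:
  assumes w: "w \<in> Omega grade W YW 0"
  shows "twice_number w = 0"
proof -
  have wW: "w \<in> W" using w Omega_subset by blast
  have lower: "YW a j w = 0" if "j > 0" for j
    by (rule Omega_vanish[OF w boson_grade]) (use that in simp)
  have "(\<Sum>i::nat. scaleW (of_int 0 gchoose i) (YW (Y a (-1 + int i) a) (0 + 1 - int i) w)) =
      YW (Y a (-1) a) 1 w"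
    by (subst Sum_any_eq_sum[of "{0}"]) (auto simp: gbinomial_0_left)
  moreover have "(\<Sum>i::nat. scaleW ((-1) powi (-1 + int i) * (of_int (-1) gchoose i))
      (YW a (1 + -1 - int i) (YW a (0 + int i) w))) = - YW a 0 (YW a 0 w)"
    by (subst Sum_any_eq_sum[of "{0}"]) (auto simp: lower)
  ultimately show ?thesis
    using jacobiW[OF wW, of a a "-1" 0 1] unfolding jacobi_identity_at_def twice_number_def
    by (simp add: lower)
qed

text \<open>
  To show that \<open>2 N w - 2 n w\<close> lies in \<open>\<Omega>\<^sub>n\<^sub>-\<^sub>1\<close>, apply a mode of degree \<open>s \<le> -n\<close>. It sends \<open>w\<close> into
  \<open>\<Omega>\<^sub>0\<close>, which \<open>N\<close> annihilates, so only the commutator \<open>-2 s\<close> and \<open>-2 n\<close> contribute. They cancel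
  for \<open>s = -n\<close>, and for \<open>s < -n\<close> the mode kills \<open>w\<close>.
\<close>

lemma twice_number_on_Gr:
  assumes w: "w \<in> Omega grade W YW n"
  shows "twice_number w - scaleW (2 * of_nat n) w \<in> Omega_pred grade W YW n"
proof (cases "n = 0")
  case True
  then show ?thesis using w twice_number_Omega_0 by (simp add: Omega_pred_def)
next
  case False
  have wW: "w \<in> W" using w Omega_subset by blast
  let ?x = "twice_number w - scaleW (2 * of_nat n) w"
  have tW: "twice_number w \<in> W" and sW: "scaleW (2 * of_nat n) w \<in> W"
    unfolding twice_number_def
    using wW by (simp_all add: YW_closed W.subspace_diff[OF carrier_subspace]
        W.subspace_scale[OF carrier_subspace])
  have x_zero: "YW v k ?x = 0" if v: "v \<in> grade d" and deg: "d - k - 1 < - int (n - 1)" for v d k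
  proof -
    have "YW v k w \<in> Omega grade W YW 0"
      using False deg by (intro Omega_mode[OF w v]) linarith
    then have "YW v k (twice_number w) = - scaleW (2 * of_int (d - k - 1)) (YW v k w)"
      using twice_number_commutator[OF wW v, of k] twice_number_Omega_0
      by (metis add_eq_0_iff2)
    then have "YW v k ?x = - scaleW (2 * of_int (d - k - 1) + 2 * of_nat n) (YW v k w)"
      using tW sW wW by (simp add: YW_vector_diff YW_vector_scale W.scale_left_distrib)
    also have "\<dots> = 0"
    proof (cases "d - k - 1 = - int n")
      case True
      then show ?thesis by (simp only: of_int_minus of_int_of_nat_eq) simp
    next
      case False
      with \<open>n \<noteq> 0\<close> deg have "YW v k w = 0" by (intro Omega_vanish[OF w v]) linarith
      then show ?thesis by simp
    qed
    finally show ?thesis .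
  qed
  have "?x \<in> Omega grade W YW (n - 1)"
    unfolding Omega_def
  proof (intro CollectI conjI allI ballI impI)
    show "?x \<in> W" by (rule W.subspace_diff[OF carrier_subspace tW sW])
  qed (rule x_zero)
  then show ?thesis unfolding Omega_pred_def using False by simp
qed

text \<open>
  The zero mode of the residue is the left-hand side of the Jacobi identity with parameters
  \<open>l = -n-m-1\<close>, \<open>n+1\<close> and \<open>m\<close>. The exponent \<open>n+1\<close> makes every term of the second sum on the right end
  in some \<open>a\<^sub>j w\<close> with \<open>j > n\<close>, which is zero.
\<close>

lemma vartheta_entry_twisted_residue:
  assumes w: "w \<in> Omega grade W YW n" and mn: "m \<le> n"
  shows "vartheta_entry grade YW k k
      (twisted_residue scale grade Y (- int n - int m - 1) (int n) a a) w =
    (\<Sum>i\<le>n - m. scaleW ((-1) ^ i * (of_int (- int n - 1) - of_nat m gchoose i))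
      (YW a (- int (m + i)) (YW a (int (m + i)) w)))"
proof -
  let ?l = "- int n - int m - 1"
  have wW: "w \<in> W" using w Omega_subset by blast
  have lower: "YW a j w = 0" if "j > int n" for j
    by (rule Omega_vanish[OF w boson_grade]) (use that in simp)
  have choose: "(of_int (int n + 1) :: complex) gchoose i = of_nat ((n + 1) choose i)" for i
    using binomial_gbinomial[of "n + 1" i, where ?'a = complex] by (simp add: add.commute)
  have "twisted_residue scale grade Y ?l (int n) a a =
      (\<Sum>j::nat. scale (of_int (int n + 1) gchoose j) (Y a (?l + int j) a))"
    unfolding twisted_residue_def V.hcomp_homogeneous[OF boson_grade]
    by (subst Sum_any_eq_sum[of "{1}"]) auto
  also have "\<dots> = (\<Sum>j\<le>n + 1. scale (of_int (int n + 1) gchoose j) (Y a (?l + int j) a))"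
    unfolding choose by (rule Sum_any_eq_sum) (auto simp: binomial_eq_0)
  finally have "vartheta_entry grade YW k k (twisted_residue scale grade Y ?l (int n) a a) w =
      (\<Sum>j\<le>n + 1. scaleW (of_int (int n + 1) gchoose j)
        (vartheta_entry grade YW k k (Y a (?l + int j) a) w))"
    by (simp only: vartheta_entry_sum[OF wW] vartheta_entry_scale[OF wW])
  also have "\<dots> = (\<Sum>j\<le>n + 1. scaleW (of_int (int n + 1) gchoose j)
        (YW (Y a (?l + int j) a) (int n + 1 + int m - int j) w))"
    by (intro sum.cong refl arg_cong[of _ _ "scaleW _"])
      (subst vartheta_entry_homogeneous[OF wW V.mode_grade[OF boson_grade boson_grade]],
        simp add: algebra_simps)
  also have "\<dots> = (\<Sum>j::nat. scaleW (of_int (int n + 1) gchoose j)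
        (YW (Y a (?l + int j) a) (int n + 1 + int m - int j) w))"
    unfolding choose by (rule Sum_any_eq_sum[symmetric]) (auto simp: binomial_eq_0)
  also have "\<dots> = (\<Sum>i::nat. scaleW ((-1) ^ i * (of_int ?l gchoose i))
        (YW a (int n + 1 + ?l - int i) (YW a (int m + int i) w)))"
    using jacobiW[OF wW, of a a ?l "int n + 1" "int m"] unfolding jacobi_identity_at_def
    by (simp add: lower)
  also have "\<dots> = (\<Sum>i\<le>n - m. scaleW ((-1) ^ i * (of_int ?l gchoose i))
        (YW a (int n + 1 + ?l - int i) (YW a (int m + int i) w)))"
    using mn by (intro Sum_any_eq_sum) (auto simp: lower)
  moreover have "int n + 1 + ?l - int i = - int (m + i)" and "int m + int i = int (m + i)"
    and "of_int ?l = (of_int (- int n - 1) - of_nat m :: complex)" for i by simp_all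
  ultimately show ?thesis by (simp only:)
qed

text \<open>
  Collecting the terms \<open>a\<^sub>-\<^sub>r a\<^sub>r\<close> with \<open>r = m + i\<close>, the coefficient is the alternating sum above, so only
  \<open>r = 0\<close> remains.
\<close>

lemma vartheta_entry_diamond_square:
  assumes w: "w \<in> Omega grade W YW n"
  shows "vartheta_entry grade YW k k (diamond_entry scale grade Y n n n a a) w = YW a 0 (YW a 0 w)"
proof -
  have wW: "w \<in> W" using w Omega_subset by blast
  let ?x = "of_int (- int n - 1) :: complex"
  let ?f = "\<lambda>r. YW a (- int r) (YW a (int r) w)"
  have "vartheta_entry grade YW k k (diamond_entry scale grade Y n n n a a) w =
      (\<Sum>m\<le>n. scaleW (?x gchoose m) (vartheta_entry grade YW k k
        (twisted_residue scale grade Y (- int n - int m - 1) (int n) a a) w))"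
    unfolding diamond_entry_def atLeast0AtMost
    by (simp add: vartheta_entry_sum[OF wW] vartheta_entry_scale[OF wW])
  also have "\<dots> = (\<Sum>m\<le>n. \<Sum>i\<le>n - m.
      scaleW ((?x gchoose m) * ((-1) ^ i * (?x - of_nat m gchoose i))) (?f (m + i)))"
    by (simp add: vartheta_entry_twisted_residue[OF w] W.scale_sum_right)
  also have "\<dots> = (\<Sum>(m, i)\<in>{(m, i). m + i \<le> n}.
      scaleW ((?x gchoose m) * ((-1) ^ i * (?x - of_nat m gchoose i))) (?f (m + i)))"
    by (subst sum.Sigma) (auto intro!: sum.cong)
  also have "\<dots> = (\<Sum>r\<le>n. \<Sum>m\<le>r. scaleW ((?x gchoose m) *
      ((-1) ^ (r - m) * (?x - of_nat m gchoose (r - m)))) (?f (m + (r - m))))"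
    by (rule sum.triangle_reindex_eq)
  also have "\<dots> = (\<Sum>r\<le>n. scaleW (\<Sum>m\<le>r. (?x gchoose m) *
      ((-1) ^ (r - m) * (?x - of_nat m gchoose (r - m)))) (?f r))"
    unfolding W.scale_sum_left by (intro sum.cong refl) simp
  also have "\<dots> = (\<Sum>r\<le>n. if r = 0 then ?f 0 else 0)"
    unfolding alternating_gbinomial_sum by (intro sum.cong) auto
  finally show ?thesis by simp
qed

lemma square_defect_on_Gr:
  assumes w: "w \<in> Omega grade W YW l" and ln: "l \<le> n"
  shows "vartheta_entry grade YW l l (V.square_defect a n) w - scaleW (2 * of_nat (n - l)) w
    \<in> Omega_pred grade W YW l"
proof -
  have wW: "w \<in> W" using w Omega_subset by blast
  have wn: "w \<in> Omega grade W YW n" using w Omega_mono[OF ln] by blast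
  have "vartheta_entry grade YW l l (Y a (-1) a) w = YW (Y a (-1) a) 1 w"
    using vartheta_entry_homogeneous[OF wW V.mode_grade[OF boson_grade boson_grade]] by simp
  moreover have "vartheta_entry grade YW l l vac w = w"
    using vartheta_entry_homogeneous[OF wW V.vac_grade] identityW[OF wW] by simp
  ultimately have "vartheta_entry grade YW l l (V.square_defect a n) w =
      scaleW (2 * of_nat n) w - twice_number w"
    unfolding V.square_defect_def twice_number_def
    by (simp add: vartheta_entry_add[OF wW] vartheta_entry_diff[OF wW] vartheta_entry_scale[OF wW]
        vartheta_entry_diamond_square[OF wn])
  then have "vartheta_entry grade YW l l (V.square_defect a n) w - scaleW (2 * of_nat (n - l)) w =
      - (twice_number w - (scaleW (2 * of_nat n) w - scaleW (2 * of_nat (n - l)) w))"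
    by (simp only: minus_diff_eq diff_diff_eq diff_diff_eq2 diff_right_commute add_diff_cancel_right' add_diff_eq)
  also have "scaleW (2 * of_nat n) w - scaleW (2 * of_nat (n - l)) w = scaleW (2 * of_nat l) w"
    using ln by (simp add: of_nat_diff flip: W.scale_left_diff_distrib)
  finally have eq: "vartheta_entry grade YW l l (V.square_defect a n) w - scaleW (2 * of_nat (n - l)) w =
      - (twice_number w - scaleW (2 * of_nat l) w)" .
  show ?thesis
    unfolding eq by (rule W.subspace_neg[OF Omega_pred_subspace twice_number_on_Gr[OF w]])
qed

end

section \<open>The vacuum of the Heisenberg module is nonzero\<close>

lemma word_scale: "word u c = tensor_scale c (word u 1)"
  by transfer (auto simp: fun_eq_iff when_def)

text \<open>Every tensor is a linear combination of words.\<close>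

lemma tensor_induct [case_names add word]:
  assumes add: "\<And>c x y. P x \<Longrightarrow> P y \<Longrightarrow> P (tensor_scale c x + y)" and word: "\<And>u. P (word u 1)"
  shows "P p"
proof -
  have "tensor_scale (-1) (word [] 1) + word [] 1 = 0" by simp
  then have "P 0" using add[OF word word] by metis
  then have "P x \<Longrightarrow> P (tensor_scale c x)" for c x using add[of x 0 c] by simp
  then have "P (word u c)" for u c using word by (metis word_scale)
  then show ?thesis
  proof (induction p rule: update_induct)
    case const
    then show ?case using \<open>P 0\<close> by simp
  next
    case (update f a b)
    have "Poly_Mapping.update a b f = word a b + f"
      using update.hyps by (intro poly_mapping_eqI)
        (auto simp: lookup_update lookup_add lookup_single when_def in_keys_iff)
    then show ?case using add[of "word a b" f 1] update by simp
  qed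
qed

text \<open>
  The Fock representation on functions of occupation numbers \<open>k\<close>, extended from finitely supported
  functions to all functions: \<open>\<alpha>(-m)\<close> acts as multiplication by a variable \<open>x\<^sub>m\<close> and \<open>\<alpha>(m)\<close> as \<open>m\<close> times
  the derivative with respect to \<open>x\<^sub>m\<close>, where \<open>f k\<close> is the coefficient of the monomial with exponents \<open>k\<close>.
\<close>

fun fock :: "heis_gen \<Rightarrow> ((nat \<Rightarrow> nat) \<Rightarrow> complex) \<Rightarrow> (nat \<Rightarrow> nat) \<Rightarrow> complex" where
  "fock Cent f = f"
| "fock (Alpha m) f = (\<lambda>k.
     if m > 0 then of_int m * of_nat (Suc (k (nat m))) * f (k(nat m := Suc (k (nat m))))
     else if m < 0 \<and> k (nat (- m)) > 0 then f (k(nat (- m) := k (nat (- m)) - 1))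
     else 0)"

lemma fock_commutator: "fock a (fock b f) k - fock b (fock a f) k = heis_bracket a b * f k"
proof (cases "\<exists>m n. a = Alpha m \<and> b = Alpha n")
  case True
  then obtain m n where ab: "a = Alpha m" "b = Alpha n" by blast
  consider "m = 0" | "n = 0" | "m > 0" "n > 0" | "m < 0" "n < 0" | "m > 0" "n < 0" | "m < 0" "n > 0"
    by linarith
  then show ?thesis
  proof cases
    case 3
    then show ?thesis by (cases "m = n") (auto simp: ab fun_upd_twist)
  next
    case 4
    then show ?thesis by (cases "m = n") (auto simp: ab fun_upd_twist)
  next
    case 5
    then show ?thesis
      by (cases "n = - m") (auto simp: ab fun_upd_twist fun_upd_idem algebra_simps)
  next
    case 6
    then show ?thesis
      by (cases "m = - n") (auto simp: ab fun_upd_twist fun_upd_idem algebra_simps)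
  qed (auto simp: ab)
next
  case False
  then show ?thesis by (cases a; cases b) auto
qed

lemma fock_linear: "fock a (\<lambda>k. c * f k + g k) = (\<lambda>k. c * fock a f k + fock a g k)"
  by (cases a) (auto simp: fun_eq_iff algebra_simps)

lemma fock_word_linear:
  "foldr fock u (\<lambda>k. c * f k + g k) = (\<lambda>k. c * foldr fock u f k + foldr fock u g k)"
  by (induction u) (simp_all add: fock_linear)

definition fock_vac :: "(nat \<Rightarrow> nat) \<Rightarrow> complex" where
  "fock_vac k = (if k = (\<lambda>_. 0) then 1 else 0)"

text \<open>
  The constant term of the vector obtained by letting a tensor act on the Fock vacuum. It respects
  the relations of the induced module and is \<open>1\<close> on the empty word.
\<close>

definition vacuum_expectation :: "heis_tensor \<Rightarrow> complex" where
  "vacuum_expectation p = (\<Sum>u. Poly_Mapping.lookup p u * foldr fock u fock_vac (\<lambda>_. 0))"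

lemma vacuum_expectation_support:
  "finite {u. Poly_Mapping.lookup p u * foldr fock u fock_vac (\<lambda>_. 0) \<noteq> 0}"
  by (rule finite_subset[OF _ finite_lookup[of p]]) auto

lemma vacuum_expectation_add:
  "vacuum_expectation (p + q) = vacuum_expectation p + vacuum_expectation q"
  unfolding vacuum_expectation_def
  using Sum_any.distrib[OF vacuum_expectation_support[of p] vacuum_expectation_support[of q]]
  by (simp add: lookup_add distrib_right)

lemma vacuum_expectation_scale:
  "vacuum_expectation (tensor_scale c p) = c * vacuum_expectation p"
  unfolding vacuum_expectation_def
  using Sum_any_right_distrib[OF vacuum_expectation_support[of p], of c]
  by (simp add: tensor_scale.rep_eq mult.assoc)

lemma vacuum_expectation_word:
  "vacuum_expectation (word u c) = c * foldr fock u fock_vac (\<lambda>_. 0)"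
  unfolding vacuum_expectation_def
  by (subst Sum_any_eq_sum[of "{u}"]) (auto simp: lookup_single when_def)

lemma vacuum_expectation_diff:
  "vacuum_expectation (p - q) = vacuum_expectation p - vacuum_expectation q"
  using vacuum_expectation_add[of "p - q" q] by simp

lemma vacuum_expectation_relation:
  assumes "p \<in> heis_relations"
  shows "vacuum_expectation p = 0"
proof -
  consider u a b w where "p = word (u @ [a, b] @ w) 1 - word (u @ [b, a] @ w) 1
        - word (u @ [Cent] @ w) (heis_bracket a b)"
    | u m where "p = word (u @ [Alpha m]) 1" "m \<ge> 0"
    | u where "p = word (u @ [Cent]) 1 - word u 1"
    using assms unfolding heis_relations_def by blast
  then show ?thesis
  proof cases
    case (1 u a b w)
    let ?g = "foldr fock w fock_vac"
    have "fock a (fock b ?g) = (\<lambda>k. heis_bracket a b * ?g k + fock b (fock a ?g) k)"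
      using fock_commutator[of a b ?g] by (simp add: fun_eq_iff algebra_simps)
    then show ?thesis
      unfolding 1 by (simp add: vacuum_expectation_diff vacuum_expectation_word fock_word_linear)
  next
    case (2 u m)
    have "fock (Alpha m) fock_vac = (\<lambda>k. 0)"
      using 2(2) by (auto simp: fock_vac_def fun_eq_iff)
    moreover have "foldr fock u (\<lambda>k. 0) = (\<lambda>k. 0)"
      using fock_word_linear[of u "-1" "\<lambda>k. 0" "\<lambda>k. 0"] by simp
    ultimately show ?thesis unfolding 2(1) by (simp add: vacuum_expectation_word)
  next
    case (3 u)
    then show ?thesis by (simp add: vacuum_expectation_diff vacuum_expectation_word)
  qed
qed

lemma vacuum_expectation_kernel: "p \<in> heis_kernel \<Longrightarrow> vacuum_expectation p = 0"
  unfolding heis_kernel_def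
proof (induction rule: tensor.span_induct_alt)
  case base
  then show ?case using vacuum_expectation_scale[of 0 0] by simp
next
  case (step c x y)
  then show ?case
    by (simp add: vacuum_expectation_add vacuum_expectation_scale vacuum_expectation_relation)
qed

lemma heis_vac_nonzero: "heis_vac \<noteq> 0"
proof (transfer, rule notI)
  assume "heis_rel (word [] 1) 0"
  then have "vacuum_expectation (word [] 1) = 0"
    using vacuum_expectation_kernel unfolding heis_rel_def by simp
  then show False by (simp add: vacuum_expectation_word fock_vac_def)
qed

section \<open>The action of the Heisenberg algebra\<close>

lemma word_commutator:
  "word ([a, b] @ w) 1 - word ([b, a] @ w) 1 - word (Cent # w) (heis_bracket a b) \<in> heis_kernel"
proof -
  have "word ([] @ [a, b] @ w) 1 - word ([] @ [b, a] @ w) 1 - word ([] @ [Cent] @ w) (heis_bracket a b)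
      \<in> heis_relations" unfolding heis_relations_def by blast
  then show ?thesis unfolding heis_kernel_def using tensor.span_base by fastforce
qed

text \<open>
  The relations identify \<open>c\<close> with \<open>1\<close> only at the right end of a word; as \<open>c\<close> is central, it can be
  moved there. Likewise the central element \<open>\<alpha>(0)\<close>, which the relations annihilate at the right end,
  is zero in every position.
\<close>

lemma word_central: "word (Cent # w) 1 - word w 1 \<in> heis_kernel"
proof (induction w)
  case Nil
  have "word ([] @ [Cent]) 1 - word [] 1 \<in> heis_relations" unfolding heis_relations_def by blast
  then show ?case unfolding heis_kernel_def using tensor.span_base by fastforce
next
  case (Cons b w)
  have "word ([Cent, b] @ w) 1 - word ([b, Cent] @ w) 1 \<in> heis_kernel"
    using word_commutator[of Cent b w] by simp
  moreover have "word (b # Cent # w) 1 - word (b # w) 1 \<in> heis_kernel"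
    using heis_kernel_cons[OF Cons.IH, of b] by (simp add: tensor_cons_diff tensor_cons_word)
  ultimately show ?case using heis_kernel_add by fastforce
qed

lemma word_alpha_zero: "word (Alpha 0 # w) 1 \<in> heis_kernel"
proof (induction w)
  case Nil
  have "word ([] @ [Alpha 0]) 1 \<in> heis_relations" unfolding heis_relations_def by blast
  then show ?case unfolding heis_kernel_def using tensor.span_base by fastforce
next
  case (Cons b w)
  have "heis_bracket (Alpha 0) b = 0" by (cases b) auto
  then have "word ([Alpha 0, b] @ w) 1 - word ([b, Alpha 0] @ w) 1 \<in> heis_kernel"
    using word_commutator[of "Alpha 0" b w] by simp
  moreover have "word (b # Alpha 0 # w) 1 \<in> heis_kernel"
    using heis_kernel_cons[OF Cons.IH, of b] by (simp add: tensor_cons_word)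
  ultimately show ?case using heis_kernel_add by fastforce
qed

lemma heis_alpha_scale: "heis_alpha m (heis_scale c v) = heis_scale c (heis_alpha m v)"
  by transfer (simp add: heis_rel_def tensor_cons_scale heis_kernel_zero)

lemma heis_alpha_zero: "heis_alpha 0 v = 0"
proof transfer
  fix p show "heis_rel (tensor_cons (Alpha 0) p) 0"
    unfolding heis_rel_def diff_zero
    by (induction p rule: tensor_induct)
      (simp_all add: tensor_cons_add tensor_cons_scale heis_kernel_add heis_kernel_scale
        tensor_cons_word word_alpha_zero)
qed

lemma heis_alpha_commutator:
  "heis_alpha m (heis_alpha n v) - heis_alpha n (heis_alpha m v) =
    heis_scale (if m + n = 0 then of_int m else 0) v"
proof transfer
  fix m n p
  let ?c = "if m + n = 0 then of_int m else 0 :: complex"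
  let ?D = "\<lambda>p. tensor_cons (Alpha m) (tensor_cons (Alpha n) p)
    - tensor_cons (Alpha n) (tensor_cons (Alpha m) p) - tensor_scale ?c p"
  have "?D p \<in> heis_kernel"
  proof (induction p rule: tensor_induct)
    case (add c x y)
    have "?D (tensor_scale c x + y) = tensor_scale c (?D x) + ?D y"
      by (simp add: tensor_cons_add tensor_cons_scale tensor.scale_right_diff_distrib
          tensor.scale_right_distrib mult.commute)
    then show ?case using add by (simp only: heis_kernel_add heis_kernel_scale)
  next
    case (word w)
    have "?D (word w 1) = (word ([Alpha m, Alpha n] @ w) 1 - word ([Alpha n, Alpha m] @ w) 1
        - word (Cent # w) (heis_bracket (Alpha m) (Alpha n)))
        + tensor_scale ?c (word (Cent # w) 1 - word w 1)"
      by (simp add: tensor_cons_word tensor.scale_right_diff_distrib flip: word_scale)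
    then show ?case
      by (simp only: heis_kernel_add word_commutator heis_kernel_scale word_central)
  qed
  then show "heis_rel (tensor_cons (Alpha m) (tensor_cons (Alpha n) p)
    - tensor_cons (Alpha n) (tensor_cons (Alpha m) p)) (tensor_scale ?c p)"
    unfolding heis_rel_def .
qed

lemma heis_alpha_vac: "m \<ge> 0 \<Longrightarrow> heis_alpha m heis_vac = 0"
proof transfer
  fix m :: int assume "m \<ge> 0"
  then have "word ([] @ [Alpha m]) 1 \<in> heis_relations" unfolding heis_relations_def by blast
  then show "heis_rel (tensor_cons (Alpha m) (word [] 1)) 0"
    unfolding heis_rel_def heis_kernel_def tensor_cons_word using tensor.span_base by fastforce
qed

abbreviation boson_power :: "nat \<Rightarrow> heis_M1" where
  "boson_power k \<equiv> (heis_alpha (-1) ^^ k) heis_vac"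

lemma heis_alpha_annihilate:
  "heis_alpha 1 (boson_power (Suc k)) = heis_scale (of_nat (Suc k)) (boson_power k)"
proof (induction k)
  case 0
  then show ?case
    using heis_alpha_commutator[of 1 "-1" heis_vac] heis_alpha_vac[of 1]
      heis_alpha_scale[of "-1" 0 0] by simp
next
  case (Suc k)
  have "heis_alpha 1 (boson_power (Suc (Suc k))) =
      heis_alpha (-1) (heis_alpha 1 (boson_power (Suc k))) + boson_power (Suc k)"
    using heis_alpha_commutator[of 1 "-1" "boson_power (Suc k)"] by (simp add: algebra_simps)
  also have "\<dots> = heis_scale (of_nat (Suc k)) (boson_power (Suc k)) + boson_power (Suc k)"
    unfolding Suc.IH heis_alpha_scale by simp
  also have "\<dots> = heis_scale (of_nat (Suc k) + 1) (boson_power (Suc k))"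
    unfolding heis.scale_left_distrib by simp
  finally show ?case by (simp add: add.commute)
qed

lemma boson_power_grade: "boson_power k \<in> heis_grade (int k)"
proof -
  have "foldr (\<lambda>i. heis_alpha (- int i)) (replicate k 1) heis_vac = boson_power k"
    by (induction k) simp_all
  then show ?thesis
    unfolding heis_grade_def
    by (intro heis.span_base CollectI exI[of _ "replicate k 1"]) (auto simp: sum_list_replicate)
qed

lemma heis_grade_negative: "d < 0 \<Longrightarrow> heis_grade d = {0}"
  unfolding heis_grade_def by (subst heis.span_empty[symmetric], rule arg_cong[of _ _ heis.span]) auto

section \<open>The failure of the diagonal shift property\<close>

lemma heisenberg_module:
  assumes "heisenberg_voa Y"
    and "lower_bounded_generalized_module heis_scale heis_grade Y heis_vac scaleW W gradeW YW"
  shows "free_boson_module heis_scale heis_grade Y heis_vac scaleW W gradeW YW heis_conf 1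
    (heis_alpha (-1) heis_vac)"
proof -
  have U: "vertex_operator_algebra heis_scale heis_grade Y heis_vac heis_conf 1"
    and Y: "\<And>m. Y (heis_alpha (-1) heis_vac) m = heis_alpha m"
    using assms(1) unfolding heisenberg_voa_def by auto
  show ?thesis
    using boson_power_grade[of 1]
    by (intro free_boson_module.intro[OF assms(2) U] free_boson_module_axioms.intro)
      (auto simp: Y heis_conf_def heis_alpha_zero)
qed

text \<open>
  Since \<open>\<alpha>(1)\<close> has degree \<open>-1\<close> and sends \<open>\<alpha>(-1)\<^bsup>k+1\<^esup>\<one>\<close> to \<open>k+1\<close> times \<open>\<alpha>(-1)\<^bsup>k\<^esup>\<one>\<close>, repeated application to such a
  vector in a lower step of the filtration would give \<open>\<one> = 0\<close>.
\<close>

lemma boson_power_not_in_Omega_pred: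
  assumes Y: "heisenberg_voa Y"
  shows "boson_power k \<notin> Omega_pred heis_grade UNIV Y k"
proof (induction k)
  case 0
  then show ?case using heis_vac_nonzero by (simp add: Omega_pred_def)
next
  case (Suc k)
  interpret vertex_operator_algebra heis_scale heis_grade Y heis_vac heis_conf 1
    using Y unfolding heisenberg_voa_def by blast
  have Ya: "Y (boson_power 1) m = heis_alpha m" for m
    using Y unfolding heisenberg_voa_def by simp
  interpret M: lower_bounded_generalized_module heis_scale heis_grade Y heis_vac
    heis_scale UNIV complex_grade Y by (rule adjoint_module)
  show ?case
  proof
    assume "boson_power (Suc k) \<in> Omega_pred heis_grade UNIV Y (Suc k)"
    then have w: "boson_power (Suc k) \<in> Omega heis_grade UNIV Y k" by (simp add: Omega_pred_def)
    have "Y (boson_power 1) 1 (boson_power (Suc k)) \<in> Omega_pred heis_grade UNIV Y k"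
    proof (cases "k = 0")
      case True
      then show ?thesis
        using M.Omega_vanish[OF w boson_power_grade[of 1], of 1] by (simp add: Omega_pred_def)
    next
      case False
      then show ?thesis
        using M.Omega_mode[OF w boson_power_grade[of 1], of 1 "k - 1"] by (simp add: Omega_pred_def)
    qed
    then have "heis_scale (1 / of_nat (Suc k)) (heis_scale (of_nat (Suc k)) (boson_power k))
        \<in> Omega_pred heis_grade UNIV Y k"
      unfolding Ya heis_alpha_annihilate by (rule heis.subspace_scale[OF M.Omega_pred_subspace])
    then show False using Suc.IH by (simp del: of_nat_Suc)
  qed
qed

theorem proposition10:
  fixes Y :: "heis_M1 \<Rightarrow> int \<Rightarrow> heis_M1 \<Rightarrow> heis_M1" and n :: nat
  assumes "heisenberg_voa Y" and "n \<ge> 1"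
  shows "\<exists>a.
    diamond heis_scale heis_grade Y
        (mat_unit (heis_alpha (-1) heis_vac) n n) (mat_unit (heis_alpha (-1) heis_vac) n n)
      - mat_unit (heis_alpha (-1) (heis_alpha (-1) heis_vac)) n n
      + mat_scale heis_scale (2 * of_nat n) (mat_unit heis_vac n n)
    = mat_unit a n n
    \<and> mat_unit a n n \<in> Q_inf TYPE('w::ab_group_add) heis_scale heis_grade Y heis_vac
    \<and> \<not> diagonal_shift_property TYPE(heis_M1) heis_scale heis_grade Y heis_vac a n n"
proof -
  let ?b = "heis_alpha (-1) heis_vac"
  interpret vertex_operator_algebra heis_scale heis_grade Y heis_vac heis_conf 1
    using assms(1) unfolding heisenberg_voa_def by blast
  have Yb: "Y ?b m = heis_alpha m" for m
    using assms(1) unfolding heisenberg_voa_def by simp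
  let ?a = "square_defect ?b n"
  have "mat_unit ?a n n \<in> Q_inf TYPE('w) heis_scale heis_grade Y heis_vac"
    unfolding Q_inf_def
  proof (intro CollectI conjI allI impI)
    show "mat_unit ?a n n \<in> U_inf"
      unfolding U_inf_def mat_unit_def by (auto intro: finite_subset[of _ "{n}"])
    fix scaleW :: "complex \<Rightarrow> 'w \<Rightarrow> 'w" and W gradeW YW
    assume "lower_bounded_generalized_module heis_scale heis_grade Y heis_vac scaleW W gradeW YW"
    then interpret M: free_boson_module heis_scale heis_grade Y heis_vac scaleW W gradeW YW
      heis_conf 1 ?b by (rule heisenberg_module[OF assms(1)])
    show "mat_unit ?a n n \<in> ker_vartheta heis_grade W YW"
      unfolding M.mat_unit_in_ker_vartheta_iff using M.square_defect_on_Gr[of _ n n] by simp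
  qed
  moreover have "\<not> diagonal_shift_property TYPE(heis_M1) heis_scale heis_grade Y heis_vac ?a n n"
  proof
    interpret M: free_boson_module heis_scale heis_grade Y heis_vac heis_scale UNIV complex_grade Y
      heis_conf 1 ?b by (rule heisenberg_module[OF assms(1) adjoint_module])
    let ?l = "n - 1"
    let ?w = "boson_power ?l"
    \<comment> \<open>The element acts on the class of \<open>?w\<close> as \<open>2 (n - (n - 1)) = 2\<close> and so would be zero only if the class were.\<close>
    assume "diagonal_shift_property TYPE(heis_M1) heis_scale heis_grade Y heis_vac ?a n n"
    then have "mat_unit ?a ?l ?l \<in> ker_vartheta heis_grade UNIV Y"
      using adjoint_module unfolding diagonal_shift_property_def Q_inf_def by blast
    moreover have w: "?w \<in> Omega heis_grade UNIV Y ?l"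
      unfolding Omega_def
    proof (intro CollectI conjI allI ballI impI UNIV_I)
      fix d k v assume "v \<in> heis_grade d" "d - k - 1 < - int ?l"
      then show "Y v k ?w = 0"
        using mode_grade[of v d ?w "int ?l" k] boson_power_grade heis_grade_negative by fastforce
    qed
    moreover note boson_power_not_in_Omega_pred[OF assms(1), of ?l]
    ultimately have "vartheta_entry heis_grade Y ?l ?l ?a ?w \<in> Omega_pred heis_grade UNIV Y ?l"
      unfolding M.mat_unit_in_ker_vartheta_iff by blast
    from heis.subspace_diff[OF M.Omega_pred_subspace this M.square_defect_on_Gr[OF w, of n]]
    have "heis_scale 2 ?w \<in> Omega_pred heis_grade UNIV Y ?l"
      using assms(2) by simp
    then have "heis_scale (1 / 2) (heis_scale 2 ?w) \<in> Omega_pred heis_grade UNIV Y ?l"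
      by (rule heis.subspace_scale[OF M.Omega_pred_subspace])
    then show False using boson_power_not_in_Omega_pred[OF assms(1), of ?l] by simp
  qed
  ultimately show ?thesis using square_defect_matrix[of ?b n] unfolding Yb by blast
qed

end
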